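(* Let $G=\langle r_0,\dots,r_{n-1}\rangle$ be a crystallographic linear Coxeter group with string diagram. Suppose that $G_{n-1}=\langle r_0,\dots,r_{n-2}\rangle$ is of Euclidean type, with $G_{n-1}=T\rtimes G_{0,n-1}$, where $T$ is the translation subgroup of $G_{n-1}$. Suppose also that the odd prime $p$ is generic for $G$ and that $G_0^p$ is a string C-group. Then $G^p$ is a string C-group.
   Context: A crystallographic linear Coxeter group with string diagram $[p_1,\dots,p_{n-1}]$ ($p_i\in\{2,3,4,6,\infty\}$) is the standard geometric representation $G=\langle r_0,\dots,r_{n-1}\rangle$ on $\mathbb{R}^n$ of the Coxeter group with relations $\rho_i^2=1$, $(\rho_{i-1}\rho_i)^{p_i}=1$, $(\rho_i\rho_j)^2=1$ ($|i-j|\ge2$), realized by a basic system of roots $b_0,\dots,b_{n-1}$ and a symmetric bilinear form with Gram matrix $[b_i\cdot b_j]$ with entries in $\mathbb{Z}[1/2]$ such that $r_i(x)=x-2\frac{x\cdot b_i}{b_i\cdot b_i}b_i$ has integral matrix. For an odd prime $p$, $G^p\le GL_n(\mathbb{Z}_p)$ is generated by the reductions mod $p$ of the $r_i$ (still called $r_i$). The prime $p$ is generic for $G$ if $p\ge5$, or $p=3$ and no $p_i$ is $6$. For $J\subseteq\{0,\dots,n-1\}$, $G_J=\langle r_j:j\notin J\rangle$, $G_J^p$ its reduction, and $G_k,G_{k,l}$ denote the cases $J=\{k\},\{k,l\}$. $G_{n-1}$ is of Euclidean type if it is an (infinite) affine Coxeter group, i.e. the form restricted to $\mathrm{span}\{b_0,\dots,b_{n-2}\}$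 is positive semidefinite with one-dimensional radical, so that $G_{n-1}$ acts as a discrete group generated by reflections on a Euclidean space; its translation subgroup $T$ is the normal subgroup of elements acting as translations. A group $\langle r_0,\dots\rangle$ reduced mod $p$ is a string C-group if $\langle r_i:i\in I\rangle\cap\langle r_i:i\in J\rangle=\langle r_i:i\in I\cap J\rangle$ for all index subsets $I,J$. *)

theory Defs
  imports
    "Jordan_Normal_Form.VS_Connect"
    "Berlekamp_Zassenhaus.Finite_Field"
    "HOL-Algebra.Generated_Groups"
    "HOL-Library.Extended_Nat"
    Complex_Main
begin

section \<open>Linear reflection groups in coordinates\<close>

text \<open>
  The real space with basic system b_0, ..., b_{n-1} is written in coordinates with respect to
  that basis: b_i is the i-th unit vector, a linear map is its matrix in the basis (b_i), and
  the bilinear form is given by its Gram matrix B = [b_i . b_j].  All matrix groups below are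
  subgroups of the general linear group, the unit group of the matrix ring.
\<close>

definition GL :: "'a::semiring_1 itself \<Rightarrow> nat \<Rightarrow> 'a mat monoid" where
  "GL ty n = units_of (ring_mat ty n ())"

definition bform :: "real mat \<Rightarrow> real vec \<Rightarrow> real vec \<Rightarrow> real" where
  "bform B x y = x \<bullet> (B *\<^sub>v y)"

definition reflection :: "nat \<Rightarrow> real mat \<Rightarrow> nat \<Rightarrow> real vec \<Rightarrow> real vec" where
  "reflection n B i x =
     x - (2 * bform B x (unit_vec n i) / bform B (unit_vec n i) (unit_vec n i))
           \<cdot>\<^sub>v unit_vec n i"

definition refl_mat :: "nat \<Rightarrow> real mat \<Rightarrow> nat \<Rightarrow> real mat" where
  "refl_mat n B i = mat n n (\<lambda>(k, l). reflection n B i (unit_vec n l) $ k)"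

text \<open>The subgroup G_J is generated by the reflections whose index is \<^emph>\<open>not\<close> in J.\<close>

definition G_par :: "nat \<Rightarrow> real mat \<Rightarrow> nat set \<Rightarrow> real mat set" where
  "G_par n B J = generate (GL TYPE(real) n) (refl_mat n B ` ({..<n} - J))"

section \<open>Crystallographic linear Coxeter groups with string diagram\<close>

text \<open>
  The diagram [p_1, ..., p_{n-1}] is a function q whose values at 1, ..., n - 1 matter; q i is
  the label of the branch joining the nodes i - 1 and i.
\<close>

definition coxeter_order :: "(nat \<Rightarrow> enat) \<Rightarrow> nat \<Rightarrow> nat \<Rightarrow> enat" where
  "coxeter_order q i j =
     (if i = j then 1 else if j = Suc i then q j else if i = Suc j then q i else 2)"

definition cos_pi_over :: "enat \<Rightarrow> real" where
  "cos_pi_over m = (case m of enat k \<Rightarrow> cos (pi / real k) | \<infinity> \<Rightarrow> 1)"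

definition Z_half :: "real set" where
  "Z_half = {x. \<exists>k::nat. 2 ^ k * x \<in> \<int>}"

text \<open>
  In the standard geometric representation the normalised roots a_i satisfy
  a_i . a_j = - cos (pi / m_ij), where m_ij is the order of the product of the i-th and j-th
  generators; the basic system consists of positive multiples of the a_i.
\<close>

definition crystallographic_string :: "nat \<Rightarrow> (nat \<Rightarrow> enat) \<Rightarrow> real mat \<Rightarrow> bool" where
  "crystallographic_string n q B \<longleftrightarrow>
     (\<forall>i\<in>{1..<n}. q i \<in> {2, 3, 4, 6, \<infinity>}) \<and>
     B \<in> carrier_mat n n \<and> transpose_mat B = B \<and>
     (\<forall>i<n. B $$ (i, i) > 0) \<and>
     (\<forall>i<n. \<forall>j<n. i \<noteq> j \<longrightarrow>
        B $$ (i, j) = - sqrt (B $$ (i, i) * B $$ (j, j)) * cos_pi_over (coxeter_order q i j)) \<and>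
     (\<forall>i<n. \<forall>j<n. B $$ (i, j) \<in> Z_half) \<and>
     (\<forall>i<n. \<forall>k<n. \<forall>l<n. refl_mat n B i $$ (k, l) \<in> \<int>)"

section \<open>Reduction modulo p\<close>

text \<open>Used on integral matrices only, where the floor just reads a real entry as an integer.\<close>

definition reduce_mat :: "real mat \<Rightarrow> 'p::prime_card mod_ring mat" where
  "reduce_mat A = map_mat (\<lambda>x. of_int \<lfloor>x\<rfloor>) A"

definition refl_mod :: "'p::prime_card itself \<Rightarrow> nat \<Rightarrow> real mat \<Rightarrow> nat \<Rightarrow> 'p mod_ring mat" where
  "refl_mod ty n B i = reduce_mat (refl_mat n B i)"

definition generic :: "nat \<Rightarrow> nat \<Rightarrow> (nat \<Rightarrow> enat) \<Rightarrow> bool" where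
  "generic p n q \<longleftrightarrow> p \<ge> 5 \<or> (p = 3 \<and> (\<forall>i\<in>{1..<n}. q i \<noteq> 6))"

text \<open>
  The intersection condition for the subgroup generated by r i, i in I.  The remaining
  requirements on a string C-group (the generators are involutions, and those with
  non-adjacent indices commute) hold automatically for the reductions modulo an odd prime of
  the generators of a linear Coxeter group with string diagram.
\<close>

definition string_C_group :: "('a, 'b) monoid_scheme \<Rightarrow> (nat \<Rightarrow> 'a) \<Rightarrow> nat set \<Rightarrow> bool" where
  "string_C_group H r I \<longleftrightarrow>
     (\<forall>K\<subseteq>I. \<forall>L\<subseteq>I.
        generate H (r ` K) \<inter> generate H (r ` L) = generate H (r ` (K \<inter> L)))"

text \<open>The group G_J^p with its distinguished generators is a string C-group.\<close>

definition reduced_string_C ::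
  "'p::prime_card itself \<Rightarrow> nat \<Rightarrow> real mat \<Rightarrow> nat set \<Rightarrow> bool" where
  "reduced_string_C ty n B J \<longleftrightarrow>
     string_C_group (GL TYPE('p mod_ring) n) (refl_mod ty n B) ({..<n} - J)"

section \<open>Euclidean type and translations\<close>

abbreviation vec_span :: "nat \<Rightarrow> real vec set \<Rightarrow> real vec set" where
  "vec_span n S \<equiv> LinearCombinations.module.span class_ring (module_vec TYPE(real) n) S"

text \<open>root_span, radical and euclidean_type concern the subgroup G_{n-1} only.\<close>

definition root_span :: "nat \<Rightarrow> real vec set" where
  "root_span n = vec_span n (unit_vec n ` {..<n - 1})"

definition radical :: "nat \<Rightarrow> real mat \<Rightarrow> real vec set" where
  "radical n B = {x \<in> root_span n. \<forall>y\<in>root_span n. bform B x y = 0}"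

definition euclidean_type :: "nat \<Rightarrow> real mat \<Rightarrow> bool" where
  "euclidean_type n B \<longleftrightarrow>
     (\<forall>x\<in>root_span n. bform B x x \<ge> 0) \<and>
     (\<exists>c\<in>carrier_vec n. c \<noteq> 0\<^sub>v n \<and> radical n B = vec_span n {c})"

definition linear_form_on :: "real vec set \<Rightarrow> (real vec \<Rightarrow> real) \<Rightarrow> bool" where
  "linear_form_on W \<phi> \<longleftrightarrow>
     (\<forall>x\<in>W. \<forall>y\<in>W. \<phi> (x + y) = \<phi> x + \<phi> y) \<and> (\<forall>a. \<forall>x\<in>W. \<phi> (a \<cdot>\<^sub>v x) = a * \<phi> x)"

text \<open>
  Let W be the span of b_0, ..., b_{n-2} and let c span its radical.  The Euclidean space on
  which G_{n-1} acts is the affine hyperplane of those linear forms f on W with f c = 1, with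
  direction space the forms vanishing at c (the dual of the positive definite space W / <c>); g
  acts contragrediently, sending f to f composed with the inverse of g.  The element g acts as a
  translation if this adds a fixed vector t of the direction space to every point.  Linear forms
  on W are represented by functions considered on W only.
\<close>

definition acts_as_translation :: "nat \<Rightarrow> real vec \<Rightarrow> real mat \<Rightarrow> bool" where
  "acts_as_translation n c g \<longleftrightarrow>
     (\<exists>t. linear_form_on (root_span n) t \<and> t c = 0 \<and>
        (\<forall>\<phi>. linear_form_on (root_span n) \<phi> \<and> \<phi> c = 1 \<longrightarrow>
           (\<forall>x\<in>root_span n. \<phi> ((inv\<^bsub>GL TYPE(real) n\<^esub> g) *\<^sub>v x) = \<phi> x + t x)))"

text \<open>
  All nonzero c in a one-dimensional radical give the same translations, since rescaling c only
  rescales the hyperplane.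
\<close>

definition translation_subgroup :: "nat \<Rightarrow> real mat \<Rightarrow> real mat set" where
  "translation_subgroup n B =
     {g \<in> G_par n B {n - 1}. \<forall>c\<in>radical n B - {0\<^sub>v n}. acts_as_translation n c g}"

definition internal_semidirect :: "('a, 'b) monoid_scheme \<Rightarrow> 'a set \<Rightarrow> 'a set \<Rightarrow> bool" where
  "internal_semidirect G N H \<longleftrightarrow>
     N \<lhd> G \<and> subgroup H G \<and> N <#>\<^bsub>G\<^esub> H = carrier G \<and> N \<inter> H = {\<one>\<^bsub>G\<^esub>}"

end

theory Submission
  imports Defs
begin

text \<open>
  By the amalgam criterion for string groups it is enough to show that the subgroups
  G_0 and <r_0, ..., r_k> of G^p meet in <r_1, ..., r_k>, for k < n - 1.  An element of the
  intersection lifts to a real element g = t h of <r_0, ..., r_k> with t a translation and h in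
  G_{0,n-1}.  On the span of b_0, ..., b_{n-2} the translation t moves each vector by a multiple
  of the radical vector c, whose coefficient at b_0 is a unit modulo p.  As t lies in G_0
  modulo p, it does not change the coefficient at b_0, so t is trivial modulo p on that span; it is
  trivial on b_{n-1} as well, because the entries of the tridiagonal Cartan matrix next to the
  diagonal are zero or units modulo p (this is where p is generic).  Hence g and h agree modulo p.

  Positivity of roots bounds the coefficients of w b_0, w in G_{0,n-1}, between 0 and those of c.
  Comparing g = t h with h at the coefficients i > k therefore gives a translation length that is
  divisible by p and at most 2 in absolute value, so t acts trivially already over the integers.
  Thus h fixes the coefficients i > k, and h lies in the parabolic subgroup <r_1, ..., r_k>.
\<close>

section \<open>Reflection words over an integral Cartan matrix\<close>

text \<open>The obstacle is that positivity and length live over the integers, while the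
  intersection is known only modulo p. Every word acts on integer coefficient vectors, and its real
  and its mod p matrix are both read off from this one action, so lifting an element means choosing
  a word. The lift over r_0, ..., r_k and the lift over r_1, ..., r_{n-1} have no relation over the
  integers; of the latter only one thing is used, that it never changes the coefficient at b_0.

  Divisibility becomes vanishing through a bound below p. Writing r_0 = t0 w0 produces the radical
  vector c = b_0 + w0 b_0, with coefficient 2 at b_0. So the roots w b_0 come in pairs with sum c,
  translations move vectors by half-integral multiples of c, and the change of the coefficient at
  b_0 is at most 2, less than any odd prime.

  A branch labelled 2 disconnects the string. Then c may vanish at some nodes, and ratios of root
  lengths are not controlled across the gap, so several steps treat this case separately.\<close>

definition unitv :: "nat \<Rightarrow> nat \<Rightarrow> int" where
  "unitv i = (\<lambda>k. if k = i then 1 else 0)"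

text \<open>With \<open>A\<close> the Cartan matrix of the roots this is 2 (x . b_i) / (b_i . b_i),
  the pairing of x with the coroot of b_i.\<close>

definition coroot :: "nat \<Rightarrow> (nat \<Rightarrow> nat \<Rightarrow> int) \<Rightarrow> nat \<Rightarrow> (nat \<Rightarrow> int) \<Rightarrow> int" where
  "coroot n A i x = (\<Sum>l<n. A i l * x l)"

text \<open>Vectors are total functions on the indices. Coefficients from \<open>n\<close> on are
  carried along unchanged by the letters below \<open>n\<close>, so no carrier set is
  needed.\<close>

definition sref :: "nat \<Rightarrow> (nat \<Rightarrow> nat \<Rightarrow> int) \<Rightarrow> nat \<Rightarrow> (nat \<Rightarrow> int) \<Rightarrow> nat \<Rightarrow> int" where
  "sref n A i x = x(i := x i - coroot n A i x)"

text \<open>\<open>foldr\<close> lets the last letter act first, so concatenation of words follows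
  the order of the matrix product.\<close>

definition act :: "nat \<Rightarrow> (nat \<Rightarrow> nat \<Rightarrow> int) \<Rightarrow> nat list \<Rightarrow> (nat \<Rightarrow> int) \<Rightarrow> nat \<Rightarrow> int" where
  "act n A ws = foldr (sref n A) ws"

lemma act_Nil [simp]: "act n A [] x = x"
  by (simp add: act_def)

lemma act_Cons: "act n A (i # ws) x = sref n A i (act n A ws x)"
  by (simp add: act_def)

lemma act_append: "act n A (us @ vs) x = act n A us (act n A vs x)"
  by (simp add: act_def)

lemma act_single [simp]: "act n A [i] x = sref n A i x"
  by (simp add: act_Cons)

lemma unitv_same [simp]: "unitv i i = 1"
  by (simp add: unitv_def)

lemma coroot_lin:
  "coroot n A i (\<lambda>k. a * x k + b * y k) = a * coroot n A i x + b * coroot n A i y"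
  by (simp add: coroot_def algebra_simps sum.distrib sum_distrib_left)

lemma coroot_unitv: "j < n \<Longrightarrow> coroot n A i (unitv j) = A i j"
  by (simp add: coroot_def unitv_def if_distrib cong: if_cong)

lemma act_lin:
  "act n A ws (\<lambda>k. a * x k + b * y k) = (\<lambda>k. a * act n A ws x k + b * act n A ws y k)"
proof (induction ws)
  case (Cons i ws)
  show ?case
    unfolding act_Cons Cons sref_def coroot_lin by (auto simp: algebra_simps)
qed simp

lemma act_diff: "act n A ws (\<lambda>k. x k - y k) k = act n A ws x k - act n A ws y k"
  using act_lin[of n A ws 1 x "-1" y] by simp

lemma act_scale: "act n A ws (\<lambda>k. a * x k) k = a * act n A ws x k"
  using act_lin[of n A ws a x 0 x] by simp

lemma act_uminus: "act n A ws (\<lambda>k. - x k) k = - act n A ws x k"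
  using act_scale[of n A ws "-1" x k] by simp

lemma act_sum:
  "finite S \<Longrightarrow> act n A ws (\<lambda>k. \<Sum>l\<in>S. a l * x l k) k = (\<Sum>l\<in>S. a l * act n A ws (x l) k)"
proof (induction S rule: finite_induct)
  case empty
  then show ?case using act_scale[of n A ws 0 "\<lambda>k. 0" k] by simp
next
  case (insert l S)
  then show ?case
    using act_lin[of n A ws "a l" "x l" 1 "\<lambda>k. \<Sum>l\<in>S. a l * x l k"] by simp
qed

lemma act_outside: "k \<notin> set ws \<Longrightarrow> act n A ws x k = x k"
  by (induction ws) (auto simp: act_Cons sref_def)

lemma coroot_cong: "(\<And>k. k < n \<Longrightarrow> x k = y k) \<Longrightarrow> coroot n A i x = coroot n A i y"
  by (simp add: coroot_def)

lemma act_cong_below: "(\<And>k. k < n \<Longrightarrow> x k = y k) \<Longrightarrow> k < n \<Longrightarrow> act n A ws x k = act n A ws y k"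
proof (induction ws arbitrary: k)
  case (Cons i ws)
  then have "coroot n A i (act n A ws x) = coroot n A i (act n A ws y)"
    by (intro coroot_cong) blast
  then show ?case using Cons by (simp add: act_Cons sref_def)
qed simp

lemma sum_unitv:
  assumes "k < n" shows "(\<Sum>l<n. x l * unitv l k) = x k"
proof -
  have "(\<Sum>l<n. x l * unitv l k) = (\<Sum>l\<in>{k}. x l * unitv l k)"
    using assms by (intro sum.mono_neutral_right) (auto simp: unitv_def)
  then show ?thesis by simp
qed

lemma act_expand:
  assumes "k < n"
  shows "act n A ws x k = (\<Sum>l<n. x l * act n A ws (unitv l) k)"
proof -
  have "act n A ws x k = act n A ws (\<lambda>k. \<Sum>l<n. x l * unitv l k) k"
    using assms by (intro act_cong_below) (auto simp: sum_unitv)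
  also have "\<dots> = (\<Sum>l<n. x l * act n A ws (unitv l) k)"
    by (rule act_sum) simp
  finally show ?thesis .
qed

lemma act_eqI_unitv:
  assumes "set ws \<subseteq> {..<n}" "set vs \<subseteq> {..<n}"
    and "\<And>l k. l < n \<Longrightarrow> k < n \<Longrightarrow> act n A ws (unitv l) k = act n A vs (unitv l) k"
  shows "act n A ws = act n A vs"
proof (intro ext)
  fix x k
  show "act n A ws x k = act n A vs x k"
  proof (cases "k < n")
    case True
    then show ?thesis
      using act_expand[OF True, of A ws x] act_expand[OF True, of A vs x] assms(3)[OF _ True] by simp
  next
    case False
    then have "k \<notin> set ws" "k \<notin> set vs" using assms(1,2) by auto
    then show ?thesis by (simp add: act_outside)
  qed
qed

section \<open>Positivity of roots in rank two\<close>

definition nonneg :: "(nat \<Rightarrow> int) \<Rightarrow> bool" where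
  "nonneg x \<longleftrightarrow> (\<forall>k. x k \<ge> 0)"

text \<open>The pair is swapped at each step so that \<open>j\<close> is always the last letter, the
  one acting first. Appending \<open>i\<close> to such a word keeps it alternating, which makes it a
  candidate for sending b_i to a positive root.\<close>

primrec altw :: "nat \<Rightarrow> nat \<Rightarrow> nat \<Rightarrow> nat list" where
  "altw i j 0 = []"
| "altw i j (Suc k) = altw j i k @ [j]"

lemma length_altw [simp]: "length (altw i j k) = k"
  by (induction k arbitrary: i j) auto

lemma set_altw: "set (altw i j k) \<subseteq> {i, j}"
  by (induction k arbitrary: i j) fastforce+

lemma altw_split: "k \<ge> m \<Longrightarrow> \<exists>us. altw i j k = us @ altw i j m \<and> set us \<subseteq> {i, j}"
proof (induction m arbitrary: i j k)
  case 0
  then show ?case using set_altw by auto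
next
  case (Suc m)
  then obtain k' where k: "k = Suc k'" "k' \<ge> m" by (cases k) auto
  then obtain us where "altw j i k' = us @ altw j i m" "set us \<subseteq> {j, i}"
    using Suc.IH by blast
  then show ?case using k by auto
qed

lemma altw_if_no_repeat:
  assumes "set u \<subseteq> {i, j}" "i \<noteq> j" "\<And>x a b. u \<noteq> a @ [x, x] @ b" "u = [] \<or> last u = j"
  shows "u = altw i j (length u)"
  using assms
proof (induction u arbitrary: i j rule: rev_induct)
  case (snoc x u)
  then have x: "x = j" by simp
  have "last u \<noteq> j" if ne: "u \<noteq> []"
  proof
    assume "last u = j"
    then obtain u' where "u = u' @ [j]" using append_butlast_last_id[OF ne] \<open>last u = j\<close> by metis
    then show False using snoc.prems(3)[of u' j "[]"] x by simp
  qed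
  then have "u = [] \<or> last u = i"
    using snoc.prems(1) last_in_set by fastforce
  moreover have "u \<noteq> a @ [y, y] @ b" for y a b
    using snoc.prems(3)[of a y "b @ [x]"] by simp
  ultimately have "u = altw j i (length u)"
    using snoc.prems(1,2) by (intro snoc.IH) auto
  then show ?case using x by simp
qed simp

text \<open>The axioms of a generalised Cartan matrix. The Coxeter theory below is proved from them
  for the linear action itself, not for a group given by relations.\<close>

locale cartan =
  fixes n :: nat and A :: "nat \<Rightarrow> nat \<Rightarrow> int"
  assumes diag: "i < n \<Longrightarrow> A i i = 2"
    and offdiag: "i < n \<Longrightarrow> j < n \<Longrightarrow> i \<noteq> j \<Longrightarrow> A i j \<le> 0"
    and zero_sym: "i < n \<Longrightarrow> j < n \<Longrightarrow> A i j = 0 \<Longrightarrow> A j i = 0"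
begin

abbreviation "co \<equiv> coroot n A"
abbreviation "ac \<equiv> act n A"
abbreviation "s \<equiv> sref n A"

lemma co_s: "i < n \<Longrightarrow> co i (s i x) = - co i x"
proof -
  assume i: "i < n"
  have "s i x = (\<lambda>k. 1 * x k + (- co i x) * unitv i k)"
    by (auto simp: sref_def unitv_def)
  then have "co i (s i x) = co i x + (- co i x) * 2"
    using i by (simp only: coroot_lin coroot_unitv diag)
  then show ?thesis by simp
qed

lemma s_invol: "i < n \<Longrightarrow> s i (s i x) = x"
  using co_s[of i x] by (auto simp: sref_def)

lemma s_unitv: "i < n \<Longrightarrow> j < n \<Longrightarrow> s i (unitv j) = (\<lambda>k. unitv j k + (- A i j) * unitv i k)"
  unfolding sref_def by (auto simp: coroot_unitv) (auto simp: unitv_def)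

lemma s_unitv_self: "i < n \<Longrightarrow> s i (unitv i) = (\<lambda>k. - unitv i k)"
  by (simp add: s_unitv diag)

lemma act_rev: "set ws \<subseteq> {..<n} \<Longrightarrow> ac ws (ac (rev ws) x) = x"
  by (induction ws arbitrary: x) (auto simp: act_Cons act_append s_invol)

lemma act_rev': "set ws \<subseteq> {..<n} \<Longrightarrow> ac (rev ws) (ac ws x) = x"
  using act_rev[of "rev ws"] by simp

lemma act_repeat: "x < n \<Longrightarrow> ac (a @ [x, x] @ b) = ac (a @ b)"
  by (auto simp: act_append act_Cons s_invol)

text \<open>On the plane x + span(b_i, b_j) both reflections act on the coordinates (u, v) by affine
  maps in which x enters only through \<open>co i x\<close> and \<open>co j x\<close>. Dihedral
  identities thus become arithmetic with two unknown integers.\<close>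

definition comb :: "(nat \<Rightarrow> int) \<Rightarrow> nat \<Rightarrow> nat \<Rightarrow> int \<Rightarrow> int \<Rightarrow> nat \<Rightarrow> int" where
  "comb x i j u v = (\<lambda>k. x k - u * unitv i k - v * unitv j k)"

lemma co_comb:
  assumes "i < n" "j < n"
  shows "co k (comb x i j u v) = co k x - u * A k i - v * A k j"
proof -
  have "comb x i j u v = (\<lambda>k. 1 * x k + (-1) * (u * unitv i k + v * unitv j k))"
    by (auto simp: comb_def algebra_simps)
  then show ?thesis
    using assms by (simp only: coroot_lin coroot_unitv) simp
qed

lemma s_comb1:
  assumes "i < n" "j < n" "i \<noteq> j"
  shows "s i (comb x i j u v) = comb x i j (co i x - u - v * A i j) v"
  unfolding sref_def co_comb[OF assms(1,2)] using assms by (auto simp: diag comb_def unitv_def)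

lemma s_comb2:
  assumes "i < n" "j < n" "i \<noteq> j"
  shows "s j (comb x i j u v) = comb x i j u (co j x - v - u * A j i)"
  unfolding sref_def co_comb[OF assms(1,2)] using assms by (auto simp: diag comb_def unitv_def)

text \<open>The order m of s_i s_j, read off from A i j * A j i = 4 cos^2(pi/m). The value 0 stands
  for infinite order.\<close>

definition dihedral_order :: "nat \<Rightarrow> nat \<Rightarrow> nat" where
  "dihedral_order i j =
     (if A i j * A j i = 0 then 2 else if A i j * A j i = 1 then 3
      else if A i j * A j i = 2 then 4 else if A i j * A j i = 3 then 6 else 0)"

lemma pair_cases:
  assumes "i < n" "j < n" "i \<noteq> j"
  obtains "A i j = 0" "A j i = 0" | "A i j = -1" "A j i = -1"
  | "A i j = -1" "A j i = -2" | "A i j = -2" "A j i = -1"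
  | "A i j = -1" "A j i = -3" | "A i j = -3" "A j i = -1"
  | "A i j * A j i \<ge> 4"
proof -
  define a b where ab: "a = - A i j" "b = - A j i"
  have nn: "a \<ge> 0" "b \<ge> 0" "a = 0 \<longleftrightarrow> b = 0"
    using assms offdiag zero_sym unfolding ab by force+
  show ?thesis
  proof (cases "a * b \<ge> 4")
    case True
    then show ?thesis using that(7) ab by simp
  next
    case False
    have "a < 4"
    proof (rule ccontr)
      assume *: "\<not> a < 4"
      then have "b \<ge> 1" using nn by linarith
      then have "a * 1 \<le> a * b" using nn(1) by (intro mult_left_mono) auto
      then show False using False * by linarith
    qed
    have "b < 4"
    proof (rule ccontr)
      assume *: "\<not> b < 4"
      then have "a \<ge> 1" using nn by linarith
      then have "1 * b \<le> a * b" using nn(2) by (intro mult_right_mono) auto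
      then show False using False * by linarith
    qed
    have "a = 0 \<or> a = 1 \<or> a = 2 \<or> a = 3" "b = 0 \<or> b = 1 \<or> b = 2 \<or> b = 3"
      using nn \<open>a < 4\<close> \<open>b < 4\<close> by arith+
    moreover have "A i j = - a" "A j i = - b" by (simp_all add: ab)
    ultimately show ?thesis using that False nn by auto
  qed
qed

text \<open>For each of the finitely many matrices of finite order, both words are run on a general
  vector in the coordinates of \<open>comb\<close>.\<close>

lemma braid:
  assumes ij: "i < n" "j < n" "i \<noteq> j" and m: "dihedral_order i j \<noteq> 0"
  shows "ac (altw i j (dihedral_order i j)) = ac (altw j i (dihedral_order i j))"
proof
  fix x
  have x: "x = comb x i j 0 0" by (simp add: comb_def)
  have "ac (altw i j (dihedral_order i j)) (comb x i j 0 0)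
      = ac (altw j i (dihedral_order i j)) (comb x i j 0 0)"
    using ij
  proof (cases rule: pair_cases)
    case 7
    then show ?thesis using m by (auto simp: dihedral_order_def)
  qed (simp_all add: dihedral_order_def eval_nat_numeral act_Cons s_comb1[OF ij] s_comb2[OF ij]
      algebra_simps)
  then show "ac (altw i j (dihedral_order i j)) x = ac (altw j i (dihedral_order i j)) x"
    by (simp add: x[symmetric])
qed

text \<open>A recurrence of Chebyshev type: s_j b_i = b_i - A j i b_j, and in the first summand the
  next letter i turns b_i into its negative, leaving the word of length k.\<close>

lemma altw_Suc_Suc:
  assumes ij: "i < n" "j < n" "i \<noteq> j"
  shows "ac (altw i j (Suc (Suc k))) (unitv i) =
    (\<lambda>l. - A j i * ac (altw j i (Suc k)) (unitv j) l - ac (altw i j k) (unitv i) l)"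
proof -
  have *: "ac (altw j i (Suc k)) (unitv i) = (\<lambda>l. - ac (altw i j k) (unitv i) l)"
    using ij by (simp add: act_append s_unitv_self act_uminus fun_eq_iff)
  have "ac (altw i j (Suc (Suc k))) (unitv i)
      = ac (altw j i (Suc k)) (\<lambda>l. 1 * unitv i l + (- A j i) * unitv j l)"
    using ij by (simp add: act_append act_Cons s_unitv)
  also have "\<dots> = (\<lambda>l. ac (altw j i (Suc k)) (unitv i) l - A j i * ac (altw j i (Suc k)) (unitv j) l)"
    unfolding act_lin by simp
  finally show ?thesis unfolding * by (auto simp: fun_eq_iff)
qed

text \<open>The recurrence subtracts the root two steps back, so positivity alone does not carry the
  induction. The second conjunct adds growth: for -A i j = 2 it says that coefficients do not
  decrease. In general the factors -A i j and -A j i allow for different root lengths, and their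
  product being at least 4 renews the estimate.\<close>

lemma altw_infinite:
  assumes "A i j * A j i \<ge> 4" "i < n" "j < n" "i \<noteq> j"
  shows "nonneg (ac (altw i j k) (unitv i)) \<and>
    (\<forall>l. - A i j * ac (altw i j (Suc k)) (unitv i) l \<ge> 2 * ac (altw j i k) (unitv j) l)"
  using assms
proof (induction k arbitrary: i j)
  case 0
  have "- A i j * (ac (altw i j (Suc 0)) (unitv i) l) \<ge> 2 * unitv j l" for l
    using 0 offdiag[of i j] by (auto simp: s_unitv) (auto simp: unitv_def mult_le_0_iff)
  then show ?case by (simp add: nonneg_def unitv_def)
next
  case (Suc k)
  have IH1: "nonneg (ac (altw i j k) (unitv i))"
    and IH2: "nonneg (ac (altw j i k) (unitv j))"
    and IH3: "\<And>l. - A i j * ac (altw i j (Suc k)) (unitv i) l \<ge> 2 * ac (altw j i k) (unitv j) l"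
    and IH4: "\<And>l. - A j i * ac (altw j i (Suc k)) (unitv j) l \<ge> 2 * ac (altw i j k) (unitv i) l"
    using Suc.IH[of i j] Suc.IH[of j i] Suc.prems by (auto simp: mult.commute)
  have neg: "A i j < 0" "A j i < 0"
    using Suc.prems offdiag[of i j] offdiag[of j i] by (auto simp: less_le)
  have nn: "0 \<le> ac (altw i j (Suc k)) (unitv i) l" for l
  proof -
    have "0 \<le> - A i j * ac (altw i j (Suc k)) (unitv i) l"
      using IH3[of l] IH2 unfolding nonneg_def by (smt (verit, ccfv_SIG))
    then show ?thesis using neg(1) by (simp add: mult_le_0_iff)
  qed
  have nn': "0 \<le> ac (altw j i (Suc k)) (unitv j) l" for l
  proof -
    have "0 \<le> - A j i * ac (altw j i (Suc k)) (unitv j) l"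
      using IH4[of l] IH1 unfolding nonneg_def by (smt (verit, ccfv_SIG))
    then show ?thesis using neg(2) by (simp add: mult_le_0_iff)
  qed
  have "- A i j * ac (altw i j (Suc (Suc k))) (unitv i) l \<ge> 2 * ac (altw j i (Suc k)) (unitv j) l" for l
  proof -
    have "2 * ac (altw i j (Suc (Suc k))) (unitv i) l \<ge> - A j i * ac (altw j i (Suc k)) (unitv j) l"
      using IH4[of l] fun_cong[OF altw_Suc_Suc[OF Suc.prems(2-4), of k], of l] by linarith
    then have "- A i j * (- A j i * ac (altw j i (Suc k)) (unitv j) l)
        \<le> - A i j * (2 * ac (altw i j (Suc (Suc k))) (unitv i) l)"
      using neg(1) by (intro mult_left_mono) auto
    moreover have "4 * ac (altw j i (Suc k)) (unitv j) l
        \<le> (A i j * A j i) * ac (altw j i (Suc k)) (unitv j) l"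
      using Suc.prems(1) nn' by (intro mult_right_mono) auto
    ultimately show ?thesis by (simp add: algebra_simps)
  qed
  then show ?case using nn by (simp add: nonneg_def)
qed

lemma nonneg_comb_unitv: "i \<noteq> j \<Longrightarrow> u \<le> 1 \<Longrightarrow> v \<le> 0 \<Longrightarrow> nonneg (comb (unitv i) i j u v)"
  by (auto simp: nonneg_def comb_def unitv_def)

text \<open>The strict bound matters: for finite order m the alternating word of length m is the
  longest element and sends b_i to a negative root.\<close>

lemma altw_nonneg:
  assumes ij: "i < n" "j < n" "i \<noteq> j" and k: "dihedral_order i j = 0 \<or> k < dihedral_order i j"
  shows "nonneg (ac (altw i j k) (unitv i))"
proof -
  have "nonneg (ac (altw i j k) (comb (unitv i) i j 0 0))" if "A i j * A j i < 4"
    using ij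
  proof (cases rule: pair_cases)
    case 7
    then show ?thesis using that by simp
  qed (use k ij in \<open>auto simp: dihedral_order_def eval_nat_numeral less_Suc_eq act_Cons
        s_comb1[OF ij] s_comb2[OF ij] coroot_unitv diag intro!: nonneg_comb_unitv\<close>)
  moreover have "comb (unitv i) i j 0 0 = unitv i" by (simp add: comb_def)
  ultimately show ?thesis
    using altw_infinite[OF _ ij, of k] by (cases "A i j * A j i < 4") auto
qed


section \<open>Reduced words and the sign of roots\<close>

text \<open>An element is its action, and length is measured over the alphabet \<open>I\<close>.
  With \<open>I\<close> a parameter the positivity theorem applies to G_{0,n-1} in its own right,
  without comparing its lengths with those in the whole group.\<close>

definition reduced :: "nat set \<Rightarrow> nat list \<Rightarrow> bool" where
  "reduced I ws \<longleftrightarrow> set ws \<subseteq> I \<and> (\<forall>vs. set vs \<subseteq> I \<longrightarrow> ac vs = ac ws \<longrightarrow> length ws \<le> length vs)"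

lemma reduced_exists:
  assumes "set ws \<subseteq> I"
  obtains vs where "reduced I vs" "ac vs = ac ws"
proof -
  define P where "P vs \<longleftrightarrow> set vs \<subseteq> I \<and> ac vs = ac ws" for vs
  define vs where "vs = arg_min length P"
  have "P ws" using assms by (simp add: P_def)
  then have "P vs" "\<And>us. P us \<Longrightarrow> length vs \<le> length us"
    unfolding vs_def by (auto intro: arg_min_natI arg_min_nat_le)
  then show ?thesis using that[of vs] unfolding P_def reduced_def by metis
qed

lemma reduced_append_right:
  assumes "reduced I (v @ u)" shows "reduced I u"
  unfolding reduced_def
proof (intro conjI allI impI)
  show "set u \<subseteq> I" using assms by (simp add: reduced_def)
  fix vs assume "set vs \<subseteq> I" "ac vs = ac u"
  then have "set (v @ vs) \<subseteq> I" "ac (v @ vs) = ac (v @ u)"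
    using assms by (auto simp: reduced_def act_append)
  then have "length (v @ u) \<le> length (v @ vs)" using assms unfolding reduced_def by blast
  then show "length u \<le> length vs" by simp
qed

lemma reduced_append_left:
  assumes "reduced I (v @ u)" shows "reduced I v"
  unfolding reduced_def
proof (intro conjI allI impI)
  show "set v \<subseteq> I" using assms by (simp add: reduced_def)
  fix vs assume "set vs \<subseteq> I" "ac vs = ac v"
  then have "set (vs @ u) \<subseteq> I" "ac (vs @ u) = ac (v @ u)"
    using assms by (auto simp: reduced_def act_append)
  then have "length (v @ u) \<le> length (vs @ u)" using assms unfolding reduced_def by blast
  then show "length v \<le> length vs" by simp
qed

text \<open>Tits' argument: a reduced word whose length does not drop on the right at i is split as v u
  with u in the dihedral subgroup of i and the last letter, and v as short as possible.\<close>

theorem reduced_nonneg: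
  assumes "reduced I ws" "I \<subseteq> {..<n}" "i \<in> I"
    and "\<And>vs. set vs \<subseteq> I \<Longrightarrow> ac vs = ac (ws @ [i]) \<Longrightarrow> length ws \<le> length vs"
  shows "nonneg (ac ws (unitv i))"
  using assms
proof (induction "length ws" arbitrary: ws i rule: less_induct)
  case less
  have I: "I \<subseteq> {..<n}" and i: "i \<in> I" "i < n" using less.prems by auto
  show ?case
  proof (cases ws rule: rev_cases)
    case Nil
    then show ?thesis by (simp add: nonneg_def unitv_def)
  next
    case (snoc ws' j)
    have j: "j \<in> I" "j < n" using less.prems(1) I snoc by (auto simp: reduced_def)
    have ij: "i \<noteq> j"
    proof
      assume "i = j"
      then have "ac ws' = ac (ws @ [i])"
        using snoc j by (auto simp: act_append act_Cons s_invol)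
      then show False
        using less.prems(4)[of ws'] less.prems(1) snoc by (auto simp: reduced_def)
    qed
    define P where "P v \<longleftrightarrow> set v \<subseteq> I \<and> (\<exists>u. set u \<subseteq> {i, j} \<and> ac (v @ u) = ac ws
        \<and> length v + length u = length ws)" for v
    define v where "v = arg_min length P"
    have P0: "P ws'"
      unfolding P_def using snoc less.prems(1) by (auto simp: reduced_def intro!: exI[of _ "[j]"])
    then have Pv: "P v" and vmin: "\<And>v'. P v' \<Longrightarrow> length v \<le> length v'"
      unfolding v_def by (auto intro: arg_min_natI arg_min_nat_le)
    have lv: "length v < length ws" using vmin[OF P0] snoc by simp
    obtain u where u: "set u \<subseteq> {i, j}" "ac (v @ u) = ac ws" "length v + length u = length ws"
      using Pv unfolding P_def by blast
    have vI: "set v \<subseteq> I" using Pv by (simp add: P_def)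
    have uI: "set u \<subseteq> I" using u(1) i j by auto
    have red: "reduced I (v @ u)"
      using less.prems(1) u vI uI unfolding reduced_def by simp
    have v_nonneg: "nonneg (ac v (unitv k))" if k: "k \<in> {i, j}" for k
    proof (rule less.hyps[OF lv])
      show "reduced I v" using red by (rule reduced_append_left)
      show "k \<in> I" using k i j by auto
      \<comment> \<open>If v k had a word shorter than v, moving the letter k over to u would give a
        shorter candidate for \<open>P\<close>.\<close>
      fix vs assume vs: "set vs \<subseteq> I" "ac vs = ac (v @ [k])"
      show "length v \<le> length vs"
      proof (rule ccontr)
        assume less_v: "\<not> length v \<le> length vs"
        have kn: "k < n" using k i j by auto
        have eq: "ac (vs @ k # u) = ac ws"
          using vs(2) kn by (auto simp: u(2)[symmetric] act_append act_Cons s_invol)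
        have "set (vs @ k # u) \<subseteq> I" using vs uI k i j by auto
        then have "length ws \<le> length (vs @ k # u)"
          using less.prems(1) eq unfolding reduced_def by blast
        then have "length vs + length (k # u) = length ws"
          using less_v u(3) by simp
        then have "P vs"
          unfolding P_def using vs(1) eq u(1) k by (intro conjI exI[of _ "k # u"]) auto
        then show False using vmin less_v by blast
      qed
    qed (use I in auto)
    have shorter: "\<not> length vs < length u" if "set vs \<subseteq> {i, j}" "ac vs = ac (u @ [i])" for vs
    proof
      assume "length vs < length u"
      moreover have "ac (v @ vs) = ac (ws @ [i])"
        by (simp add: act_append fun_eq_iff that(2) u(2)[symmetric])
      ultimately show False
        using less.prems(4)[of "v @ vs"] that(1) vI i j u(3) by auto
    qed
    have redu: "reduced I u" using red by (rule reduced_append_right)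
    have u_alt: "u = altw i j (length u)"
    proof (rule altw_if_no_repeat[OF u(1) ij])
      fix x a b
      show "u \<noteq> a @ [x, x] @ b"
      proof
        assume eq: "u = a @ [x, x] @ b"
        then have "ac (a @ b) = ac u" "set (a @ b) \<subseteq> I" using uI I act_repeat[of x a b] by auto
        then have "length u \<le> length (a @ b)" using redu unfolding reduced_def by blast
        then show False using eq by simp
      qed
      show "u = [] \<or> last u = j"
      proof (rule ccontr)
        assume "\<not> (u = [] \<or> last u = j)"
        then have "u \<noteq> []" "last u = i" using u(1) last_in_set by fastforce+
        then obtain u' where u': "u = u' @ [i]" by (metis append_butlast_last_id)
        then have "ac u' = ac (u @ [i])" using i(2) by (intro ext) (simp add: act_append act_Cons s_invol)
        then show False using shorter[of u'] u(1) u' by simp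
      qed
    qed
    \<comment> \<open>Otherwise u ends in an alternating word of braid length. The braid relation
      rewrites it to end in i, which cancels the appended i and makes u i shorter than u.\<close>
    have "dihedral_order i j = 0 \<or> length u < dihedral_order i j"
    proof (rule ccontr)
      assume *: "\<not> (dihedral_order i j = 0 \<or> length u < dihedral_order i j)"
      then obtain us where us: "u = us @ altw i j (dihedral_order i j)" "set us \<subseteq> {i, j}"
        using altw_split[of "dihedral_order i j" "length u" i j] u_alt by auto
      obtain m where m: "dihedral_order i j = Suc m" using * by (cases "dihedral_order i j") auto
      have "ac u = (\<lambda>x. ac us (ac (altw i j (dihedral_order i j)) x))"
        using arg_cong[OF us(1), of ac] by (simp add: fun_eq_iff act_append)
      also have "\<dots> = (\<lambda>x. ac us (ac (altw j i (dihedral_order i j)) x))"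
        using braid[OF i(2) j(2) ij] * by simp
      finally have "ac u x = ac us (ac (altw i j m) (s i x))" for x
        by (simp add: m act_append)
      then have "ac (us @ altw i j m) = ac (u @ [i])"
        using i(2) by (intro ext) (simp add: act_append s_invol)
      then show False
        using shorter[of "us @ altw i j m"] us set_altw[of i j m] m by auto
    qed
    then have pos: "nonneg (ac u (unitv i))"
      using altw_nonneg[OF i(2) j(2) ij, of "length u"] u_alt by simp
    \<comment> \<open>u b_i is a nonnegative combination of b_i and b_j, and v keeps both of these
      positive by its minimality.\<close>
    define y where "y = ac u (unitv i)"
    have y0: "y k = 0" if "k \<notin> {i, j}" for k
      unfolding y_def using that u(1) by (subst act_outside) (auto simp: unitv_def)
    have "ac ws (unitv i) = ac v y" by (simp add: u(2)[symmetric] act_append y_def)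
    also have "y = (\<lambda>k. y i * unitv i k + y j * unitv j k)"
      using y0 ij by (auto simp: unitv_def)
    also have "ac v \<dots> = (\<lambda>k. y i * ac v (unitv i) k + y j * ac v (unitv j) k)"
      by (rule act_lin)
    finally show ?thesis
      using pos v_nonneg[of i] v_nonneg[of j] by (auto simp: nonneg_def y_def)
  qed
qed

lemma descent_nonpos:
  assumes "reduced I (ws @ [i])" "I \<subseteq> {..<n}"
  shows "ac (ws @ [i]) (unitv i) k \<le> 0"
proof -
  have i: "i \<in> I" "i < n" using assms by (auto simp: reduced_def)
  have "nonneg (ac ws (unitv i))"
  proof (rule reduced_nonneg[OF _ assms(2) i(1)])
    show "reduced I ws" using assms(1) by (rule reduced_append_left)
    fix vs assume "set vs \<subseteq> I" "ac vs = ac (ws @ [i])"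
    then have "length (ws @ [i]) \<le> length vs" using assms(1) unfolding reduced_def by blast
    then show "length ws \<le> length vs" by simp
  qed
  moreover have "ac (ws @ [i]) (unitv i) k = - ac ws (unitv i) k"
    using i by (simp add: act_append s_unitv_self act_uminus)
  ultimately show ?thesis by (simp add: nonneg_def)
qed

text \<open>Either appending i does not shorten the element, and the root is nonnegative, or it
  does, and the root is nonpositive by \<open>descent_nonpos\<close>. One positive coefficient rules
  out the second case.\<close>

lemma root_sign:
  assumes "set ws \<subseteq> {..<n}" "i < n" "ac ws (unitv i) k > 0"
  shows "nonneg (ac ws (unitv i))"
proof -
  obtain vs where vs: "reduced {..<n} vs" "ac vs = ac ws"
    using reduced_exists assms(1) by blast
  have "set (vs @ [i]) \<subseteq> {..<n}" using vs(1) assms(2) by (simp add: reduced_def)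
  then obtain us where us: "reduced {..<n} us" "ac us = ac (vs @ [i])"
    using reduced_exists by blast
  show ?thesis
  proof (cases "length vs \<le> length us")
    case True
    have "nonneg (ac vs (unitv i))"
    proof (rule reduced_nonneg[OF vs(1)])
      fix vs' assume "set vs' \<subseteq> {..<n}" "ac vs' = ac (vs @ [i])"
      then have "length us \<le> length vs'" using us unfolding reduced_def by metis
      then show "length vs \<le> length vs'" using True by simp
    qed (use assms(2) in auto)
    then show ?thesis using vs(2) by simp
  next
    case False
    have *: "ac (us @ [i]) = ac ws"
      using us(2) vs(2) assms(2) by (auto simp: act_append s_invol)
    have "reduced {..<n} (us @ [i])"
      unfolding reduced_def
    proof (intro conjI allI impI)
      fix vs' assume "set vs' \<subseteq> {..<n}" "ac vs' = ac (us @ [i])"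
      then have "length vs \<le> length vs'" using vs * unfolding reduced_def by metis
      then show "length (us @ [i]) \<le> length vs'" using False by simp
    qed (use us(1) assms(2) in \<open>auto simp: reduced_def\<close>)
    then have "ac (us @ [i]) (unitv i) k \<le> 0" by (rule descent_nonpos) simp
    then show ?thesis using assms(3) * by simp
  qed
qed

text \<open>Let j be the last letter of a reduced word for \<open>h\<close>. By
  \<open>descent_nonpos\<close> the image of b_j has coefficient at most 0 at j, but for j outside
  \<open>K\<close> this coefficient would be 1; so j is in \<open>K\<close>. Removing j changes
  images only by multiples of the image of b_j, which has no coefficients at \<open>I - K\<close>,
  so the induction continues.\<close>

lemma parabolic_stabilizer:
  assumes "set h \<subseteq> I" "I \<subseteq> {..<n}" "K \<subseteq> I"
    and "\<And>i j. i \<in> I - K \<Longrightarrow> j \<in> I \<Longrightarrow> ac h (unitv j) i = unitv j i"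
  obtains us where "set us \<subseteq> K" "ac us = ac h"
proof -
  have "\<exists>us. set us \<subseteq> K \<and> ac us = ac ws"
    if "reduced I ws" "\<And>i j. i \<in> I - K \<Longrightarrow> j \<in> I \<Longrightarrow> ac ws (unitv j) i = unitv j i" for ws
    using that
  proof (induction ws rule: rev_induct)
    case (snoc j ws)
    have j: "j \<in> I" "j < n" using snoc.prems(1) assms(2) by (auto simp: reduced_def)
    have jK: "j \<in> K"
    proof (rule ccontr)
      assume "j \<notin> K"
      then have "ac (ws @ [j]) (unitv j) j = 1" using snoc.prems(2)[of j j] j by simp
      then show False using descent_nonpos[OF snoc.prems(1) assms(2), of j] by simp
    qed
    have "\<exists>us. set us \<subseteq> K \<and> ac us = ac ws"
    proof (rule snoc.IH)
      show "reduced I ws" using snoc.prems(1) by (rule reduced_append_left)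
      fix i l assume il: "i \<in> I - K" "l \<in> I"
      then have ln: "l < n" "i \<noteq> j" using assms(2) jK by auto
      have "ac ws (unitv l) i = ac (ws @ [j]) (s j (unitv l)) i"
        using j by (simp add: act_append s_invol)
      also have "\<dots> = ac (ws @ [j]) (\<lambda>k. 1 * unitv l k + (- A j l) * unitv j k) i"
        using j ln by (simp only: s_unitv mult_1)
      also have "\<dots> = unitv l i + (- A j l) * unitv j i"
        unfolding act_lin using snoc.prems(2) il j by simp
      finally show "ac ws (unitv l) i = unitv l i" using ln by (simp add: unitv_def)
    qed
    then obtain us where "set us \<subseteq> K" "ac us = ac ws" by blast
    then show ?case using jK by (intro exI[of _ "us @ [j]"]) (auto simp: act_append fun_eq_iff)
  qed (auto intro: exI[of _ "[]"])
  moreover obtain ws where ws: "reduced I ws" "ac ws = ac h"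
    using reduced_exists assms(1) by blast
  ultimately show ?thesis using that assms(4) by metis
qed

end

section \<open>Translations modulo an odd prime\<close>

text \<open>The locale is stated in integers: c spans the radical of the affine part, scaled so that c = e_0 + w0 e_0,
  where w0 is the linear part of the reflection r_0 (r_0 = t w0 with t a translation).\<close>

locale euclidean_cartan = cartan +
  fixes d :: "nat \<Rightarrow> real" and c :: "nat \<Rightarrow> int" and w0 :: "nat list" and p :: int
  assumes n_ge_2: "n \<ge> 2"
    and string: "i < n \<Longrightarrow> j < n \<Longrightarrow> Suc i < j \<Longrightarrow> A i j = 0"
    and d_pos: "i < n \<Longrightarrow> d i > 0"
    and d_sym: "i < n \<Longrightarrow> j < n \<Longrightarrow> d i * A i j = d j * A j i"
    and w0: "set w0 \<subseteq> {1..<n - 1}"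
    and c_eq: "c k = unitv 0 k + act n A w0 (unitv 0) k"
    and c_radical: "j < n - 1 \<Longrightarrow> coroot n A j c = 0"
    and radical_unique: "(\<And>k. n - 1 \<le> k \<Longrightarrow> y k = 0) \<Longrightarrow> (\<And>j. j < n - 1 \<Longrightarrow> coroot n A j y = 0)
      \<Longrightarrow> 2 * y i = y 0 * c i"
    and split: "set g \<subseteq> {..<n - 1} \<Longrightarrow> \<exists>t h. set t \<subseteq> {..<n - 1} \<and> set h \<subseteq> {1..<n - 1} \<and>
      act n A g = act n A (t @ h) \<and>
      (\<forall>x. (\<forall>k\<ge>n - 1. x k = 0) \<longrightarrow> (\<forall>i. 2 * (act n A t x i - x i) = (act n A t x 0 - x 0) * c i))"
    and prime_p: "prime p" and odd_p: "odd p"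
    and unit_up: "Suc i < n \<Longrightarrow> A i (Suc i) \<noteq> 0 \<Longrightarrow> \<not> p dvd A i (Suc i)"
    and unit_down: "Suc i < n \<Longrightarrow> A (Suc i) i \<noteq> 0 \<Longrightarrow> \<not> p dvd A (Suc i) i"
begin

text \<open>Since c has leading coefficient 2, a translation t moves x by half of
  its change in coefficient 0, times c.\<close>

definition translation :: "nat list \<Rightarrow> bool" where
  "translation t \<longleftrightarrow> set t \<subseteq> {..<n - 1} \<and>
     (\<forall>x. (\<forall>k\<ge>n - 1. x k = 0) \<longrightarrow> (\<forall>i. 2 * (ac t x i - x i) = (ac t x 0 - x 0) * c i))"

lemma translationD:
  "translation t \<Longrightarrow> (\<And>k. k \<ge> n - 1 \<Longrightarrow> x k = 0) \<Longrightarrow> 2 * (ac t x i - x i) = (ac t x 0 - x 0) * c i"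
  by (simp add: translation_def)

lemma subset_shift: "X \<subseteq> {1..<n - 1} \<Longrightarrow> X \<subseteq> {..<n}"
  by (rule subset_trans) auto

lemma c_outside: "k \<ge> n - 1 \<Longrightarrow> c k = 0"
  using w0 n_ge_2 by (simp add: c_eq) (subst act_outside, auto simp: unitv_def)

lemma c_0: "c 0 = 2"
  using w0 by (simp add: c_eq) (subst act_outside, auto)

lemma act_c: "set g \<subseteq> {..<n - 1} \<Longrightarrow> ac g c = c"
  by (induction g) (auto simp: act_Cons sref_def c_radical)

lemma p_dvd_two_mult: "p dvd 2 * x \<Longrightarrow> p dvd x"
proof -
  assume "p dvd 2 * x"
  moreover have "\<not> p dvd 2"
  proof
    assume "p dvd 2"
    then have "p = 2" using prime_p by (metis primes_dvd_imp_eq two_is_prime_nat prime_nat_int_transfer of_nat_numeral)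
    then show False using odd_p by simp
  qed
  ultimately show ?thesis using prime_p by (simp add: prime_dvd_mult_iff)
qed

text \<open>As w fixes c = b_0 + w0 b_0, the difference c - w b_0 is the root w w0 b_0 of the same
  kind. The upper bound is therefore the lower bound for another word.\<close>

lemma root_bounds:
  assumes "set w \<subseteq> {1..<n - 1}"
  shows "0 \<le> ac w (unitv 0) i" "ac w (unitv 0) i \<le> c i"
proof -
  have *: "0 \<le> ac v (unitv 0) i" if "set v \<subseteq> {1..<n - 1}" for v
  proof -
    \<comment> \<open>No letter 0 occurs, so the coefficient at b_0 stays 1 and decides the sign of
      the root.\<close>
    have "ac v (unitv 0) 0 = 1" using that by (subst act_outside) auto
    then have "nonneg (ac v (unitv 0))"
      using subset_shift[OF that] n_ge_2 by (intro root_sign[where k = 0]) auto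
    then show ?thesis by (simp add: nonneg_def)
  qed
  show "0 \<le> ac w (unitv 0) i" using * assms by blast
  have "ac (w @ w0) (unitv 0) i = ac w (\<lambda>k. c k - unitv 0 k) i"
    by (simp add: act_append c_eq)
  also have "\<dots> = c i - ac w (unitv 0) i"
  proof -
    have "ac w c = c" using assms by (intro act_c) auto
    then show ?thesis by (simp add: act_diff)
  qed
  finally show "ac w (unitv 0) i \<le> c i" using *[of "w @ w0"] assms w0 by simp
qed

section \<open>The invariant bilinear form\<close>

text \<open>For \<open>d i\<close> = b_i . b_i this is 2 (x . y).\<close>

definition form :: "(nat \<Rightarrow> int) \<Rightarrow> (nat \<Rightarrow> int) \<Rightarrow> real" where
  "form x y = (\<Sum>i<n. d i * x i * co i y)"

lemma form_sym: "form x y = form y x"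
proof -
  have expand: "form x y = (\<Sum>i<n. \<Sum>j<n. d i * A i j * x i * y j)" for x y
    by (simp add: form_def coroot_def sum_distrib_left mult_ac)
  have "form x y = (\<Sum>i<n. \<Sum>j<n. d j * A j i * x i * y j)"
    unfolding expand by (intro sum.cong refl) (simp add: d_sym)
  also have "\<dots> = form y x"
    unfolding expand by (subst sum.swap) (simp add: mult_ac)
  finally show ?thesis .
qed

lemma form_lin: "form (\<lambda>k. a * x k + b * y k) z = a * form x z + b * form y z"
  by (simp add: form_def sum.distrib sum_distrib_left algebra_simps)

lemma form_lin': "form z (\<lambda>k. a * x k + b * y k) = a * form z x + b * form z y"
  by (simp add: form_sym[of z] form_lin)

lemma form_unitv: "i < n \<Longrightarrow> form (unitv i) y = d i * co i y"
proof -
  assume i: "i < n"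
  have "form (unitv i) y = (\<Sum>k\<in>{i}. d k * unitv i k * co k y)"
    unfolding form_def using i by (intro sum.mono_neutral_right) (auto simp: unitv_def)
  then show ?thesis by simp
qed

lemma form_s:
  assumes i: "i < n"
  shows "form (s i x) (s i y) = form x y"
proof -
  have *: "s i z = (\<lambda>k. 1 * z k + (- co i z) * unitv i k)" for z
    by (auto simp: sref_def unitv_def)
  have s1: "form (s i z) z' = form z z' - co i z * (d i * co i z')" for z z'
  proof -
    have "form (s i z) z' = form (\<lambda>k. 1 * z k + (- co i z) * unitv i k) z'" by (simp only: *)
    also have "\<dots> = of_int 1 * form z z' + of_int (- co i z) * form (unitv i) z'" by (rule form_lin)
    finally show ?thesis using i by (simp add: form_unitv)
  qed
  have "form (s i x) (s i y) = form x (s i y) + co i x * d i * co i y"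
    using i by (simp add: s1 co_s)
  also have "form x (s i y) = form x y - co i y * (d i * co i x)"
    by (simp add: form_sym[of x] s1)
  finally show ?thesis by simp
qed

lemma form_act: "set g \<subseteq> {..<n} \<Longrightarrow> form (ac g x) (ac g y) = form x y"
  by (induction g) (auto simp: act_Cons form_s)

lemma form_c: "(\<And>k. k \<ge> n - 1 \<Longrightarrow> x k = 0) \<Longrightarrow> form x c = 0"
proof -
  assume x: "\<And>k. k \<ge> n - 1 \<Longrightarrow> x k = 0"
  have "d i * x i * co i c = 0" for i
    using x[of i] c_radical[of i] by (cases "i < n - 1") auto
  then show ?thesis unfolding form_def by (intro sum.neutral ballI)
qed

lemma form_c_last: "n \<ge> 3 \<Longrightarrow> form c (unitv (n - 1)) = d (n - 2) * c (n - 2) * A (n - 2) (n - 1)"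
proof -
  assume n: "n \<ge> 3"
  have "d i * c i * co i (unitv (n - 1)) = 0" if "i < n" "i \<noteq> n - 2" for i
  proof (cases "i = n - 1")
    case True
    then show ?thesis by (simp add: c_outside)
  next
    case False
    then show ?thesis using that n string[of i "n - 1"] by (simp add: coroot_unitv)
  qed
  then have "form c (unitv (n - 1)) = (\<Sum>i\<in>{n - 2}. d i * c i * co i (unitv (n - 1)))"
    unfolding form_def using n by (intro sum.mono_neutral_right) auto
  then show ?thesis using n by (simp add: coroot_unitv)
qed

section \<open>Cuts in the string diagram\<close>

text \<open>A branch labelled 2 separates node \<open>j\<close> from node 0.\<close>

definition broken :: "nat \<Rightarrow> bool" where
  "broken j \<longleftrightarrow> (\<exists>m. 1 \<le> m \<and> m \<le> j \<and> A m (m - 1) = 0)"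

lemma broken_orthogonal:
  assumes "1 \<le> m" "m < n" "A m (m - 1) = 0" "i < m" "m \<le> l" "l < n"
  shows "A i l = 0" "A l i = 0"
proof -
  show "A i l = 0"
  proof (cases "Suc i < l")
    case True
    then show ?thesis using string assms by simp
  next
    case False
    then have "l = m" "i = m - 1" using assms by linarith+
    then show ?thesis using assms zero_sym[of m "m - 1"] by simp
  qed
  then show "A l i = 0" using zero_sym[of i l] assms by simp
qed

text \<open>Reflections at nodes below the cut see only coefficients below it, all zero; the others
  change only coefficients from m on.\<close>

lemma broken_preserves:
  assumes m: "1 \<le> m" "m < n" "A m (m - 1) = 0" and "\<And>k. k < m \<Longrightarrow> x k = 0" "k < m"
  shows "ac t x k = 0"
  using assms(4,5)
proof (induction t arbitrary: k)
  case (Cons i t)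
  have "co i (ac t x) = 0" if "i < m"
    unfolding coroot_def
  proof (intro sum.neutral ballI)
    fix l assume "l \<in> {..<n}"
    then show "A i l * ac t x l = 0"
      using Cons.IH[of l] Cons.prems(1) broken_orthogonal(1)[OF m that, of l]
      by (cases "l < m") auto
  qed
  then show ?case using Cons by (auto simp: act_Cons sref_def)
qed simp

section \<open>Translations over the integers and modulo p\<close>

text \<open>As s_{j+1} b_j = b_j - A (j+1) j b_{j+1} with a nonzero factor, triviality passes from
  the orbit of b_j to that of b_{j+1}; quantifying over all w makes room for the extra letter j + 1.
  Behind a cut \<open>broken_preserves\<close> takes over, since nothing there ever acquires a
  coefficient at b_0.\<close>

lemma translation_trivial:
  assumes t: "translation t"
    and orbit: "\<And>w. set w \<subseteq> {1..<n - 1} \<Longrightarrow> ac t (ac w (unitv 0)) 0 = ac w (unitv 0) 0"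
    and x: "\<And>k. k \<ge> n - 1 \<Longrightarrow> x k = 0"
  shows "ac t x 0 = x 0"
proof -
  have chain: "(\<forall>w. set w \<subseteq> {1..<n - 1} \<longrightarrow> ac t (ac w (unitv j)) 0 = ac w (unitv j) 0) \<or> broken j"
    if "j < n - 1" for j
    using that
  proof (induction j)
    case 0
    then show ?case using orbit by blast
  next
    case (Suc j)
    show ?case
    proof (cases "broken j \<or> A (Suc j) j = 0")
      case True
      then have "broken (Suc j)"
        unfolding broken_def by (metis diff_Suc_1 le_SucI le_add1 le_refl plus_1_eq_Suc)
      then show ?thesis by simp
    next
      case False
      then have IH: "\<And>w. set w \<subseteq> {1..<n - 1} \<Longrightarrow> ac t (ac w (unitv j)) 0 = ac w (unitv j) 0"
        using Suc by simp
      have "ac t (ac w (unitv (Suc j))) 0 = ac w (unitv (Suc j)) 0" if w: "set w \<subseteq> {1..<n - 1}" for w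
      proof -
        have "s (Suc j) (unitv j) = (\<lambda>k. 1 * unitv j k + (- A (Suc j) j) * unitv (Suc j) k)"
          using Suc.prems by (simp add: s_unitv)
        then have *: "ac (w @ [Suc j]) (unitv j)
            = (\<lambda>k. 1 * ac w (unitv j) k + (- A (Suc j) j) * ac w (unitv (Suc j)) k)"
          by (simp only: act_append act_single act_lin)
        have "ac t (ac (w @ [Suc j]) (unitv j)) 0 = ac (w @ [Suc j]) (unitv j) 0"
          using Suc.prems w by (intro IH) auto
        then show ?thesis
          unfolding * act_lin using IH[OF w] False by simp
      qed
      then show ?thesis by simp
    qed
  qed
  have unit: "ac t (unitv l) 0 = unitv l 0" if l: "l < n - 1" for l
  proof (cases "broken l")
    case True
    then obtain m where m: "1 \<le> m" "m \<le> l" "A m (m - 1) = 0" by (auto simp: broken_def)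
    have "ac t (unitv l) 0 = 0"
      using m l by (intro broken_preserves[of m]) (auto simp: unitv_def)
    then show ?thesis using m by (simp add: unitv_def)
  next
    case False
    then have "ac t (ac [] (unitv l)) 0 = ac [] (unitv l) 0" using chain[OF l]
      by (metis empty_set empty_subsetI)
    then show ?thesis by simp
  qed
  have "ac t x 0 = (\<Sum>l<n. x l * ac t (unitv l) 0)"
    using n_ge_2 by (intro act_expand) simp
  also have "\<dots> = (\<Sum>l<n. x l * unitv l 0)"
  proof (intro sum.cong refl)
    fix l assume "l \<in> {..<n}"
    then show "x l * ac t (unitv l) 0 = x l * unitv l 0"
      using unit[of l] x[of l] by (cases "l < n - 1") auto
  qed
  also have "\<dots> = x 0" using n_ge_2 by (simp add: sum_unitv)
  finally show ?thesis .
qed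

text \<open>By \<open>d_sym\<close> neighbouring squared root lengths have a quotient of Cartan
  entries as their ratio. Along an uncut string these entries are nonzero, hence units modulo p, and
  the ratios multiply. As \<open>d\<close> is real, the ratio is expressed by integers u and v prime
  to p.\<close>

lemma norm_ratio:
  assumes "i \<le> j" "j < n" "\<not> broken j"
  shows "\<exists>u v. \<not> p dvd u \<and> \<not> p dvd v \<and> d i * u = d j * real_of_int v"
  using assms
proof (induction j)
  case 0
  have "\<not> p dvd 1" using prime_p not_prime_unit by blast
  then show ?case using 0 by (intro exI[of _ 1]) auto
next
  case (Suc j)
  show ?case
  proof (cases "i = Suc j")
    case True
    have "\<not> p dvd 1" using prime_p not_prime_unit by blast
    then show ?thesis using True by (intro exI[of _ 1]) auto
  next
    case False
    have "\<not> broken j" and A: "A (Suc j) j \<noteq> 0"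
      using Suc.prems(3) unfolding broken_def by (auto dest: le_SucI)
    then obtain u v where uv: "\<not> p dvd u" "\<not> p dvd v" "d i * u = d j * real_of_int v"
      using Suc False by auto
    have A': "A j (Suc j) \<noteq> 0" using A zero_sym[of j "Suc j"] Suc.prems by auto
    have "d i * (u * A j (Suc j)) = d j * real_of_int (A j (Suc j)) * v"
      using uv(3) by simp
    also have "\<dots> = d (Suc j) * real_of_int (v * A (Suc j) j)"
      using d_sym[of j "Suc j"] Suc.prems by simp
    finally have "d i * real_of_int (u * A j (Suc j)) = d (Suc j) * real_of_int (v * A (Suc j) j)"
      by simp
    moreover have "\<not> p dvd u * A j (Suc j)" "\<not> p dvd v * A (Suc j) j"
      using uv A A' unit_up unit_down Suc.prems prime_p by (simp_all add: prime_dvd_mult_iff)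
    ultimately show ?thesis by blast
  qed
qed

text \<open>On the span of b_0, ..., b_{n-2} this follows from the form of a translation. The vector
  b = b_{n-1} is moved by some w in that span. Invariance of the form, applied to b_j and b,
  expresses the pairing of w with b_j by the displacement of b_j, which p divides. For an uncut
  string these pairings together with w 0 determine w modulo p.\<close>

lemma translation_congruent:
  assumes t: "translation t" and first: "\<And>x. p dvd ac t x 0 - x 0"
  shows "p dvd ac t x k - x k"
proof -
  have tn: "set t \<subseteq> {..<n - 1}" using t unfolding translation_def by simp
  have tset: "set t \<subseteq> {..<n}" by (rule subset_trans[OF tn]) auto
  have W: "p dvd ac t x k - x k" if "\<And>k. k \<ge> n - 1 \<Longrightarrow> x k = 0" for x k
  proof (rule p_dvd_two_mult)
    have "2 * (ac t x k - x k) = (ac t x 0 - x 0) * c k"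
      using that by (rule translationD[OF t])
    then show "p dvd 2 * (ac t x k - x k)" using first[of x] by (metis dvd_mult2)
  qed
  define b where "b = unitv (n - 1)"
  define w where "w k = ac t b k - b k" for k
  have w_out: "w k = 0" if "k \<ge> n - 1" for k
    unfolding w_def using tn that by (subst act_outside) auto
  have tb: "ac t b = (\<lambda>k. 1 * b k + 1 * w k)" by (auto simp: w_def)
  have form_w: "2 * (d j * co j w) = - ((ac t (unitv j) 0 - unitv j 0) * form c b)" if j: "j < n - 1" for j
  proof -
    define l where "l = ac t (unitv j) 0 - unitv j 0"
    have eW: "unitv j k = 0" if "k \<ge> n - 1" for k using that j by (simp add: unitv_def)
    have "2 * ac t (unitv j) k = 2 * unitv j k + l * c k" for k
    proof -
      have "2 * (ac t (unitv j) k - unitv j k) = l * c k"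
        unfolding l_def using eW by (rule translationD[OF t])
      then show ?thesis by (simp only: right_diff_distrib diff_eq_eq add.commute)
    qed
    then have "form (\<lambda>k. 2 * ac t (unitv j) k + 0 * c k) (ac t b) = form (\<lambda>k. 2 * unitv j k + l * c k) (ac t b)"
      by simp
    then have "2 * form (ac t (unitv j)) (ac t b) = 2 * form (unitv j) (ac t b) + l * form c (ac t b)"
      unfolding form_lin[of 2 "ac t (unitv j)" 0 c] form_lin[of 2 "unitv j" l c] by simp
    moreover have "form (ac t (unitv j)) (ac t b) = form (unitv j) b" by (rule form_act[OF tset])
    moreover have "form (unitv j) (ac t b) = form (unitv j) b + form (unitv j) w"
      unfolding tb form_lin'[of _ 1 b 1 w] by simp
    moreover have "form c (ac t b) = form c b"
      unfolding tb form_lin'[of _ 1 b 1 w] using form_c[OF w_out] by (simp add: form_sym[of c])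
    moreover have "form (unitv j) w = d j * co j w" using j by (intro form_unitv) simp
    ultimately show ?thesis unfolding l_def by simp
  qed
  have w_dvd: "p dvd w k" for k
  proof (cases "n = 2")
    case True
    have "w k = 0" if "k \<noteq> 0" using w_out[of k] True that by simp
    then show ?thesis using first[of b] by (cases "k = 0") (auto simp: w_def)
  next
    case False
    then have n: "n \<ge> 3" using n_ge_2 by simp
    show ?thesis
    proof (cases "broken (n - 2)")
      case True
      then obtain m where m: "1 \<le> m" "m \<le> n - 2" "A m (m - 1) = 0" by (auto simp: broken_def)
      \<comment> \<open>Erasing the coefficients of c below m leaves a radical vector, because the
        two sides of the cut are orthogonal, but now the coefficient at b_0 is 0. By
        \<open>radical_unique\<close> it vanishes, and with it the coefficient of c at n -
        2.\<close>
      define c' where "c' = (\<lambda>k. if k < m then 0 else c k)"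
      have "co j c' = 0" if j: "j < n - 1" for j
      proof (cases "j < m")
        case True
        show ?thesis unfolding coroot_def c'_def
          using broken_orthogonal(1)[of m j] m n True by (intro sum.neutral) auto
      next
        case False
        have "co j c' = co j c" unfolding coroot_def c'_def
          using broken_orthogonal(2)[of m _ j] m n False j by (intro sum.cong) auto
        then show ?thesis using c_radical j by simp
      qed
      then have "2 * c' (n - 2) = c' 0 * c (n - 2)"
        by (intro radical_unique) (auto simp: c'_def c_outside)
      then have "c (n - 2) = 0" using m by (simp add: c'_def split: if_splits)
      then have "form c b = 0" using form_c_last[OF n] by (simp add: b_def)
      have co_w: "co j w = 0" if "j < n - 1" for j
      proof -
        have "d j > 0" using that by (intro d_pos) simp
        then show ?thesis using form_w[OF that] \<open>form c b = 0\<close> by simp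
      qed
      have "2 * w k = w 0 * c k" by (rule radical_unique[of w k, OF w_out co_w])
      moreover have "p dvd w 0 * c k" using first[of b] by (simp add: w_def)
      ultimately show ?thesis by (metis p_dvd_two_mult)
    next
      case False
      have co_dvd: "p dvd co j w" if j: "j < n - 1" for j
      proof -
        have jn: "j \<le> n - 2" "n - 2 < n" using j by auto
        \<comment> \<open>Trading the real factor d j for d (n - 2) lets the latter cancel, which
          leaves an equation between integers.\<close>
        obtain u v where uv: "\<not> p dvd u" "\<not> p dvd v" "d j * u = d (n - 2) * real_of_int v"
          using norm_ratio[OF jn False] by blast
        define l where "l = ac t (unitv j) 0 - unitv j 0"
        have "d (n - 2) * real_of_int (2 * v * co j w) = 2 * (d j * co j w) * u"
          using uv(3) by simp
        also have "\<dots> = - (l * (d (n - 2) * c (n - 2) * A (n - 2) (n - 1))) * u"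
          using form_w[OF j] form_c_last[OF n] by (simp add: l_def b_def)
        also have "\<dots> = d (n - 2) * real_of_int (- (l * c (n - 2) * A (n - 2) (n - 1) * u))"
          by simp
        finally have "d (n - 2) * real_of_int (2 * v * co j w)
            = d (n - 2) * real_of_int (- (l * c (n - 2) * A (n - 2) (n - 1) * u))" .
        moreover have "d (n - 2) \<noteq> 0" using d_pos[of "n - 2"] n by simp
        ultimately have "real_of_int (2 * v * co j w) = real_of_int (- (l * c (n - 2) * A (n - 2) (n - 1) * u))"
          by (simp only: mult_cancel_left simp_thms)
        then have "2 * (v * co j w) = - (l * c (n - 2) * A (n - 2) (n - 1) * u)"
          by (simp only: of_int_eq_iff mult.assoc)
        moreover have "p dvd l" unfolding l_def by (rule first)
        ultimately have "p dvd 2 * (v * co j w)" by simp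
        then have "p dvd v * co j w" by (rule p_dvd_two_mult)
        then show ?thesis using uv(2) prime_p by (simp add: prime_dvd_mult_iff)
      qed
      \<comment> \<open>Row i of the Cartan matrix ends at column i + 1 with a unit, so the pairing
        with b_i yields coefficient i + 1 from the earlier ones.\<close>
      have "p dvd w j" if "j < n - 1" for j
        using that
      proof (induction j rule: less_induct)
        case (less j)
        show ?case
        proof (cases j)
          case 0
          then show ?thesis using first[of b] by (simp add: w_def)
        next
          case (Suc i)
          have A0: "A i (Suc i) \<noteq> 0"
          proof
            assume "A i (Suc i) = 0"
            then have "A (Suc i) i = 0" using zero_sym[of i "Suc i"] less.prems Suc by simp
            then have "broken (n - 2)" unfolding broken_def
              using less.prems Suc by (intro exI[of _ "Suc i"]) auto
            then show False using False by simp
          qed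
          have "co i w = (\<Sum>l\<in>insert (Suc i) {..<Suc i}. A i l * w l)"
            unfolding coroot_def
          proof (rule sum.mono_neutral_right)
            show "\<forall>l\<in>{..<n} - insert (Suc i) {..<Suc i}. A i l * w l = 0"
            proof
              fix l assume "l \<in> {..<n} - insert (Suc i) {..<Suc i}"
              then have "A i l = 0" using less.prems Suc by (intro string) auto
              then show "A i l * w l = 0" by simp
            qed
          qed (use less.prems Suc in auto)
          also have "\<dots> = A i (Suc i) * w (Suc i) + (\<Sum>l<Suc i. A i l * w l)"
            by (subst sum.insert) auto
          finally have eq: "A i (Suc i) * w (Suc i) = co i w - (\<Sum>l<Suc i. A i l * w l)" by simp
          have "p dvd (\<Sum>l<Suc i. A i l * w l)"
            using less Suc by (intro dvd_sum dvd_mult) auto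
          then have "p dvd A i (Suc i) * w (Suc i)"
            unfolding eq using co_dvd[of i] less.prems Suc by (intro dvd_diff) auto
          then show ?thesis
            using unit_up[OF _ A0] less.prems Suc prime_p by (simp add: prime_dvd_mult_iff)
        qed
      qed
      then show ?thesis using w_out[of k] by (cases "k < n - 1") auto
    qed
  qed
  show ?thesis
  proof (cases "k < n")
    case True
    have "ac t x k - x k = (\<Sum>l<n. x l * ac t (unitv l) k) - (\<Sum>l<n. x l * unitv l k)"
      using True act_expand[OF True, of A t x] act_expand[OF True, of A "[]" x] by simp
    also have "\<dots> = (\<Sum>l<n. x l * (ac t (unitv l) k - unitv l k))"
      by (simp add: algebra_simps sum_subtractf)
    also have "p dvd \<dots>"
    proof (intro dvd_sum dvd_mult)
      fix l assume "l \<in> {..<n}"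
      then consider "l < n - 1" | "l = n - 1" by fastforce
      then show "p dvd ac t (unitv l) k - unitv l k"
      proof cases
        case 1
        then show ?thesis by (intro W) (auto simp: unitv_def)
      next
        case 2
        then show ?thesis using w_dvd[of k] by (simp add: w_def b_def)
      qed
    qed
    finally show ?thesis .
  next
    case False
    then show ?thesis using tset by (subst act_outside) auto
  qed
qed

section \<open>The intersection in terms of words\<close>

definition congruent :: "nat list \<Rightarrow> nat list \<Rightarrow> bool" where
  "congruent ws vs \<longleftrightarrow> (\<forall>x k. p dvd ac ws x k - ac vs x k)"

text \<open>\<open>congruent\<close> is equality in G^p, so this is the inclusion that
  \<open>string_C_groupI\<close> asks for, in the range where <r_0, ..., r_k> lies in the Euclidean
  group.\<close>

theorem parabolic_congruent:
  assumes k: "k < n - 1" and g: "set g \<subseteq> {..k}" and v: "set v \<subseteq> {1..<n}"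
    and gv: "congruent g v"
  obtains us where "set us \<subseteq> {1..k}" "congruent us g"
proof -
  have "set g \<subseteq> {..<n - 1}" using g k by auto
  from split[OF this] obtain t h where t: "translation t" and h: "set h \<subseteq> {1..<n - 1}"
    and g_eq: "ac g = ac (t @ h)" unfolding translation_def by blast
  have hn: "set h \<subseteq> {..<n}" using h by (rule subset_shift)
  \<comment> \<open>At h^{-1} x the word g acts as t does on x, while v h^{-1} has no letter 0 and
    keeps the coefficient at b_0.\<close>
  have first: "p dvd ac t x 0 - x 0" for x
  proof -
    have "ac g (ac (rev h) x) = ac t x" by (simp add: g_eq act_append act_rev[OF hn])
    moreover have "ac v (ac (rev h) x) 0 = x 0"
      using v h by (simp add: act_append[symmetric]) (subst act_outside, auto)
    ultimately show ?thesis using gv unfolding congruent_def by metis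
  qed
  have t1: "p dvd ac t x i - x i" for x i by (rule translation_congruent[OF t first])
  have h_fix: "ac h x i = x i" if i: "k < i" "i < n - 1" and x: "\<And>l. l \<ge> n - 1 \<Longrightarrow> x l = 0" for x i
  proof -
    define l where "l y = ac t y 0 - y 0" for y
    \<comment> \<open>The word g has no letter i and keeps coefficient i, so there t must undo
      exactly what h does.\<close>
    have hx: "2 * (x i - ac h x i) = l (ac h x) * c i" if x: "\<And>l. l \<ge> n - 1 \<Longrightarrow> x l = 0" for x
    proof -
      have "ac h x m = 0" if "m \<ge> n - 1" for m
      proof -
        have "m \<notin> set h" using h that by auto
        then show ?thesis using x[OF that] by (simp add: act_outside)
      qed
      then have "2 * (ac t (ac h x) i - ac h x i) = l (ac h x) * c i"
        unfolding l_def by (rule translationD[OF t])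
      moreover have "ac t (ac h x) i = ac g x i" by (simp add: g_eq act_append)
      moreover have "ac g x i = x i" using g i by (intro act_outside) auto
      ultimately show ?thesis by simp
    qed
    have hxx: "2 * (x i - ac h x i) = l (ac h x) * c i" using x by (rule hx)
    show ?thesis
    proof (cases "c i = 0")
      case True
      then show ?thesis using hxx by simp
    next
      case False
      have "ac t (ac w (unitv 0)) 0 = ac w (unitv 0) 0" if w: "set w \<subseteq> {1..<n - 1}" for w
      proof -
        \<comment> \<open>The preimage of w b_0 under h is in the same orbit of b_0, so it and its
          image both lie between 0 and c.\<close>
        define x' where "x' = ac (rev h @ w) (unitv 0)"
        have hx': "ac h x' = ac w (unitv 0)" by (simp add: x'_def act_append act_rev[OF hn])
        have "x' m = 0" if "m \<ge> n - 1" for m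
          unfolding x'_def using w h that n_ge_2 by (subst act_outside) (auto simp: unitv_def)
        then have eq: "2 * (x' i - ac w (unitv 0) i) = l (ac w (unitv 0)) * c i"
          using hx[of x'] unfolding hx' by blast
        have "0 \<le> x' i" "x' i \<le> c i" "0 \<le> ac w (unitv 0) i" "ac w (unitv 0) i \<le> c i"
          unfolding x'_def using root_bounds[of "rev h @ w" i] root_bounds[of w i] w h by simp_all
        \<comment> \<open>Two integers between 0 and c i differ by at most c i; the factor 2 is the
          coefficient of c at b_0. Cancelling c i leaves a multiple of p of absolute value at most
          2, hence 0.\<close>
        then have ci: "c i > 0" and "\<bar>2 * (x' i - ac w (unitv 0) i)\<bar> \<le> 2 * c i"
          using False by auto
        then have "\<bar>l (ac w (unitv 0))\<bar> * c i \<le> 2 * c i" unfolding eq by (simp add: abs_mult)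
        then have "\<bar>l (ac w (unitv 0))\<bar> \<le> 2" using ci by simp
        moreover have "p dvd l (ac w (unitv 0))" unfolding l_def by (rule first)
        moreover have "p > 2"
          using prime_p odd_p prime_ge_2_int[of p] by (cases "p = 2") auto
        ultimately have "l (ac w (unitv 0)) = 0"
          using dvd_imp_le_int[of "l (ac w (unitv 0))" p] by linarith
        then show ?thesis by (simp add: l_def)
      qed
      moreover have "ac h x m = 0" if "m \<ge> n - 1" for m
      proof -
        have "m \<notin> set h" using h that by auto
        then show ?thesis using x[OF that] by (simp add: act_outside)
      qed
      ultimately have "ac t (ac h x) 0 = ac h x 0"
        by (rule translation_trivial[OF t])
      then have "l (ac h x) = 0" by (simp add: l_def)
      then show ?thesis using hxx by simp
    qed
  qed
  obtain us where us: "set us \<subseteq> {1..k}" "ac us = ac h"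
  proof (rule parabolic_stabilizer[OF h, of "{1..k}"])
    fix i j assume "i \<in> {1..<n - 1} - {1..k}" "j \<in> {1..<n - 1}"
    then show "ac h (unitv j) i = unitv j i" by (intro h_fix) (auto simp: unitv_def)
  qed (use k in auto)
  have "congruent us g"
    unfolding congruent_def
  proof (intro allI)
    fix x m
    show "p dvd ac us x m - ac g x m"
      using t1[of "ac h x" m] by (simp add: us(2) g_eq act_append dvd_diff_commute)
  qed
  then show ?thesis using that us(1) by blast
qed

end

section \<open>A criterion for string C-groups\<close>

context group
begin

text \<open>The generators are involutions, so words without inverse letters already exhaust the
  subgroup.\<close>

lemma generate_words:
  assumes "\<And>i. i \<in> I \<Longrightarrow> r i \<in> carrier G \<and> r i \<otimes> r i = \<one>"
    and M_Nil: "M [] = \<one>" and M_Cons: "\<And>i ws. i \<in> I \<Longrightarrow> set ws \<subseteq> I \<Longrightarrow> M (i # ws) = r i \<otimes> M ws"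
  shows "generate G (r ` I) = M ` {ws. set ws \<subseteq> I}"
proof (intro subset_antisym subsetI)
  have M_carrier: "M ws \<in> carrier G" if "set ws \<subseteq> I" for ws
    using that by (induction ws) (auto simp: M_Nil M_Cons assms(1))
  have M_append: "M (us @ vs) = M us \<otimes> M vs" if "set us \<subseteq> I" "set vs \<subseteq> I" for us vs
    using that by (induction us) (auto simp: M_Nil M_Cons M_carrier assms(1) m_assoc)
  have single: "M [i] = r i" if "i \<in> I" for i
    using that by (simp add: M_Cons M_Nil assms(1))
  fix g
  show "g \<in> M ` {ws. set ws \<subseteq> I}" if "g \<in> generate G (r ` I)"
    using that
  proof (induction g rule: generate.induct)
    case one
    then show ?case using M_Nil by (intro image_eqI[of _ _ "[]"]) auto
  next
    case (incl h)
    then obtain i where "i \<in> I" "h = r i" by auto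
    then show ?case using single by (intro image_eqI[of _ _ "[i]"]) auto
  next
    case (inv h)
    then obtain i where i: "i \<in> I" "h = r i" by auto
    then have "inv h = r i" using assms(1) by (intro inv_equality) auto
    then show ?case using single i by (intro image_eqI[of _ _ "[i]"]) auto
  next
    case (eng h1 h2)
    then obtain us vs where "h1 = M us" "h2 = M vs" "set us \<subseteq> I" "set vs \<subseteq> I" by auto
    then show ?case using M_append by (intro image_eqI[of _ _ "us @ vs"]) auto
  qed
  show "g \<in> generate G (r ` I)" if g: "g \<in> M ` {ws. set ws \<subseteq> I}"
  proof -
    obtain ws where "g = M ws" "set ws \<subseteq> I" using g by auto
    then show ?thesis
    proof (induction ws arbitrary: g)
      case Nil
      then show ?case by (simp add: M_Nil generate.one)
    next
      case (Cons i ws)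
      then show ?case by (auto simp: M_Cons intro!: generate.eng[OF generate.incl])
    qed
  qed
qed

lemma commutes_generate:
  assumes "z \<in> carrier G" "X \<subseteq> carrier G" "\<And>x. x \<in> X \<Longrightarrow> z \<otimes> x = x \<otimes> z" "g \<in> generate G X"
  shows "z \<otimes> g = g \<otimes> z"
  using assms(4)
proof (induction g rule: generate.induct)
  case (inv h)
  then have h: "h \<in> carrier G" using assms(2) by auto
  have "inv h \<otimes> (h \<otimes> z) \<otimes> inv h = z \<otimes> inv h"
    using h assms(1) by (simp add: m_assoc[symmetric])
  moreover have "inv h \<otimes> (z \<otimes> h) \<otimes> inv h = inv h \<otimes> z"
    using h assms(1) by (simp add: m_assoc)
  ultimately show ?case using assms(3) inv by simp
next
  case (eng h1 h2)
  then have h: "h1 \<in> carrier G" "h2 \<in> carrier G"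
    using generate_in_carrier[OF assms(2)] by auto
  have "z \<otimes> (h1 \<otimes> h2) = h1 \<otimes> (z \<otimes> h2)"
    using eng.IH(1) h assms(1) by (simp add: m_assoc[symmetric])
  then show ?case using eng.IH(2) h assms(1) by (simp add: m_assoc)
qed (use assms in auto)

lemma generate_Un_commuting:
  assumes X: "X \<subseteq> carrier G" and Y: "Y \<subseteq> carrier G"
    and comm: "\<And>x y. x \<in> X \<Longrightarrow> y \<in> Y \<Longrightarrow> x \<otimes> y = y \<otimes> x"
    and g: "g \<in> generate G (X \<union> Y)"
  obtains a b where "a \<in> generate G X" "b \<in> generate G Y" "g = a \<otimes> b"
proof -
  have XY: "b \<otimes> a = a \<otimes> b" if "a \<in> generate G X" "b \<in> generate G Y" for a b
  proof (rule commutes_generate[OF _ X _ that(1)])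
    show b: "b \<in> carrier G" using generate_in_carrier[OF Y that(2)] .
    fix x assume "x \<in> X"
    then show "b \<otimes> x = x \<otimes> b"
      using commutes_generate[OF _ Y _ that(2), of x] X comm by auto
  qed
  have "\<exists>a b. a \<in> generate G X \<and> b \<in> generate G Y \<and> g = a \<otimes> b"
    using g
  proof (induction g rule: generate.induct)
    case one
    then show ?case using generate.one[of G] r_one by (metis one_closed)
  next
    case (incl h)
    then show ?case
    proof
      assume "h \<in> X"
      then show ?thesis using X generate.one[of G Y] generate.incl[of h X G] by (metis r_one subsetD)
    next
      assume "h \<in> Y"
      then show ?thesis using Y generate.one[of G X] generate.incl[of h Y G] by (metis l_one subsetD)
    qed
  next
    case (inv h)
    then show ?case
    proof
      assume "h \<in> X"
      then show ?thesis using X generate.one[of G Y] generate.inv[of h X G] by (metis r_one subsetD inv_closed)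
    next
      assume "h \<in> Y"
      then show ?thesis using Y generate.one[of G X] generate.inv[of h Y G] by (metis l_one subsetD inv_closed)
    qed
  next
    case (eng h1 h2)
    then obtain a b a' b' where ab: "a \<in> generate G X" "b \<in> generate G Y" "h1 = a \<otimes> b"
      "a' \<in> generate G X" "b' \<in> generate G Y" "h2 = a' \<otimes> b'" by blast
    have carr: "a \<in> carrier G" "b \<in> carrier G" "a' \<in> carrier G" "b' \<in> carrier G"
      using generate_in_carrier[OF X] generate_in_carrier[OF Y] ab(1,2,4,5) by blast+
    have "h1 \<otimes> h2 = a \<otimes> (b \<otimes> a') \<otimes> b'" using carr by (simp add: ab(3,6) m_assoc)
    also have "\<dots> = a \<otimes> (a' \<otimes> b) \<otimes> b'" using XY[OF ab(4,2)] by simp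
    also have "\<dots> = (a \<otimes> a') \<otimes> (b \<otimes> b')" using carr by (simp add: m_assoc)
    finally show ?case using generate.eng[OF ab(1,4)] generate.eng[OF ab(2,5)] by blast
  qed
  then show ?thesis using that by blast
qed

text \<open>Split each of the two index sets into its initial run {..k}, if it has one, and a rest that
  commutes with that run.\<close>

theorem string_C_groupI:
  assumes r: "\<And>i. i < n \<Longrightarrow> r i \<in> carrier G"
    and comm: "\<And>i j. i < n \<Longrightarrow> j < n \<Longrightarrow> Suc i < j \<Longrightarrow> r i \<otimes> r j = r j \<otimes> r i"
    and C0: "string_C_group G r {1..<n}"
    and inter: "\<And>k. k < n \<Longrightarrow> generate G (r ` {..k}) \<inter> generate G (r ` {1..<n}) \<subseteq> generate G (r ` {1..k})"
  shows "string_C_group G r {..<n}"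
proof -
  \<comment> \<open>Otherwise the simplifier turns the 1 in \<open>{1..<n}\<close> into
    \<open>Suc 0\<close>.\<close>
  note One_nat_def [simp del]
  define gen where "gen K = generate G (r ` K)" for K
  have carr: "r ` K \<subseteq> carrier G" if "K \<subseteq> {..<n}" for K using that r by auto
  have sub: "subgroup (gen K) G" if "K \<subseteq> {..<n}" for K
    unfolding gen_def using carr[OF that] by (rule generate_is_subgroup)
  have mono: "gen K \<subseteq> gen L" if "K \<subseteq> L" "L \<subseteq> {..<n}" for K L
    unfolding gen_def using that by (intro mono_generate image_mono)
  have C0': "gen K \<inter> gen L = gen (K \<inter> L)" if "K \<subseteq> {1..<n}" "L \<subseteq> {1..<n}" for K L
    using C0 that unfolding string_C_group_def gen_def by blast
  have inter': "x \<in> gen {1..k}" if "k < n" "x \<in> gen {..k}" "x \<in> gen {1..<n}" for x k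
    using inter that unfolding gen_def by blast
  have run: "\<exists>k K'. k < n \<and> K = {..k} \<union> K' \<and> K' \<subseteq> {Suc (Suc k)..<n}"
    if K: "K \<subseteq> {..<n}" "0 \<in> K" for K
  proof -
    define m where "m = (LEAST m. m \<notin> K)"
    have "n \<notin> K" using K by auto
    then have m: "m \<notin> K" "m \<le> n" unfolding m_def
      using LeastI[of "\<lambda>m. m \<notin> K" n] Least_le[of "\<lambda>m. m \<notin> K" n] by blast+
    have "j \<in> K" if "j < m" for j using that not_less_Least unfolding m_def by blast
    moreover obtain k where k: "m = Suc k" using m K by (cases m) auto
    ultimately have "K = {..k} \<union> (K - {..k})" by auto
    moreover have "K - {..k} \<subseteq> {Suc (Suc k)..<n}"
    proof
      fix x assume "x \<in> K - {..k}"
      moreover from this have "x \<noteq> Suc k" using m k by auto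
      ultimately show "x \<in> {Suc (Suc k)..<n}" using K by auto
    qed
    ultimately show ?thesis using m k by (intro exI[of _ k] exI[of _ "K - {..k}"]) auto
  qed
  have factor: "\<exists>a b. a \<in> gen {..k} \<and> b \<in> gen K' \<and> x = a \<otimes> b"
    if "k < n" "K' \<subseteq> {Suc (Suc k)..<n}" "x \<in> gen ({..k} \<union> K')" for k K' x
  proof -
    have "x \<in> generate G (r ` {..k} \<union> r ` K')" using that(3) by (simp add: gen_def image_Un)
    moreover have "r ` {..k} \<subseteq> carrier G" "r ` K' \<subseteq> carrier G" using that(1,2) by (auto intro!: r)
    moreover have "x \<otimes> y = y \<otimes> x" if "x \<in> r ` {..k}" "y \<in> r ` K'" for x y
      using that \<open>K' \<subseteq> _\<close> \<open>k < n\<close> by (auto intro!: comm)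
    ultimately show ?thesis unfolding gen_def by (metis generate_Un_commuting)
  qed
  \<comment> \<open>In x = a b the factor b avoids r_0, so a lies in G_0 as well and can be written
    without r_0. The condition for G_0 then applies to x.\<close>
  have one_sided: "gen K \<inter> gen L \<subseteq> gen (K \<inter> L)"
    if K: "K \<subseteq> {..<n}" "0 \<in> K" and L: "L \<subseteq> {1..<n}" for K L
  proof
    fix x assume x: "x \<in> gen K \<inter> gen L"
    obtain k K' where k: "k < n" "K = {..k} \<union> K'" "K' \<subseteq> {Suc (Suc k)..<n}" using run[OF K] by blast
    obtain a b where ab: "a \<in> gen {..k}" "b \<in> gen K'" "x = a \<otimes> b"
      using factor[of k K' x] k x by auto
    interpret G0: subgroup "gen {1..<n}" G by (rule sub) auto
    have G0: "gen L \<subseteq> gen {1..<n}" "gen K' \<subseteq> gen {1..<n}"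
      using k(3) L by - (rule mono; force)+
    have xG: "x \<in> gen {1..<n}" and bG: "b \<in> gen {1..<n}" using x ab(2) G0 by auto
    have "{..k} \<subseteq> {..<n}" using k(1) by auto
    then have ac: "a \<in> carrier G"
      using generate_in_carrier[OF carr] ab(1) unfolding gen_def by blast
    have "b \<in> carrier G" using bG by (rule G0.mem_carrier)
    then have "a = x \<otimes> inv b" using ab(3) ac by (simp add: m_assoc)
    then have "a \<in> gen {1..<n}" using xG bG by simp
    then have "a \<in> gen {1..k}" using inter' k ab by blast
    interpret K0: subgroup "gen (K - {0})" G using K by (intro sub) auto
    have "gen {1..k} \<subseteq> gen (K - {0})" "gen K' \<subseteq> gen (K - {0})"
      using k K by - (rule mono; force)+
    then have "x \<in> gen (K - {0})" using \<open>a \<in> gen {1..k}\<close> ab by auto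
    then have "x \<in> gen (K - {0}) \<inter> gen L" using x by simp
    also have "\<dots> = gen ((K - {0}) \<inter> L)" using K L by (intro C0') auto
    also have "\<dots> \<subseteq> gen (K \<inter> L)" using K by (intro mono) auto
    finally show "x \<in> gen (K \<inter> L)" .
  qed
  \<comment> \<open>From x = a b = a' b' the element a^{-1} a' = b b'^{-1} lies in <r_0, ..., r_l>
    and in G_0, hence in <r_1, ..., r_l>. So b belongs to the subgroup of \<open>L - {0}\<close>,
    and the condition for G_0, applied to \<open>K'\<close> and \<open>L - {0}\<close>, puts it into
    that of \<open>K \<inter> L\<close>. The factor a is there already because k is at most
    l.\<close>
  have two_sided: "gen K \<inter> gen L \<subseteq> gen (K \<inter> L)"
    if k: "k < n" "K = {..k} \<union> K'" "K' \<subseteq> {Suc (Suc k)..<n}"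
      and l: "l < n" "L = {..l} \<union> L'" "L' \<subseteq> {Suc (Suc l)..<n}" and kl: "k \<le> l"
    for k l K L K' L'
  proof
    fix x assume x: "x \<in> gen K \<inter> gen L"
    obtain a b where ab: "a \<in> gen {..k}" "b \<in> gen K'" "x = a \<otimes> b"
      using factor[of k K' x] k x by auto
    obtain a' b' where ab': "a' \<in> gen {..l}" "b' \<in> gen L'" "x = a' \<otimes> b'"
      using factor[of l L' x] l x by auto
    have KL: "K \<subseteq> {..<n}" "L \<subseteq> {..<n}" using k l by auto
    interpret G0: subgroup "gen {1..<n}" G by (rule sub) auto
    interpret Gl: subgroup "gen {..l}" G using l by (intro sub) auto
    interpret L0: subgroup "gen (L - {0})" G using KL by (intro sub) auto
    interpret KL: subgroup "gen (K \<inter> L)" G using KL by (intro sub) auto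
    have "gen K' \<subseteq> gen {1..<n}" "gen L' \<subseteq> gen {1..<n}" "gen {..k} \<subseteq> gen {..l}"
      using k l kl by - (rule mono; force)+
    then have b: "b \<in> gen {1..<n}" "b' \<in> gen {1..<n}" "a \<in> gen {..l}"
      using ab ab' by auto
    have eq: "inv a \<otimes> a' = b \<otimes> inv b'"
    proof -
      have "inv a \<otimes> (a \<otimes> b) \<otimes> inv b' = inv a \<otimes> (a' \<otimes> b') \<otimes> inv b'"
        using ab(3) ab'(3) by simp
      moreover have "inv a \<otimes> (a \<otimes> b) = b" using b by (simp add: m_assoc[symmetric])
      moreover have "inv a \<otimes> (a' \<otimes> b') \<otimes> inv b' = inv a \<otimes> a'" using b ab' by (simp add: m_assoc)
      ultimately show ?thesis by simp
    qed
    have "b \<otimes> inv b' \<in> gen {..l}" using ab' b by (simp add: eq[symmetric])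
    moreover have "b \<otimes> inv b' \<in> gen {1..<n}" using b by simp
    ultimately have "b \<otimes> inv b' \<in> gen {1..l}" using inter' l by blast
    moreover have "gen {1..l} \<subseteq> gen (L - {0})" "gen L' \<subseteq> gen (L - {0})"
      using l KL by - (rule mono; force)+
    ultimately have "b \<otimes> inv b' \<in> gen (L - {0})" "b' \<in> gen (L - {0})" using ab' by auto
    then have "b \<otimes> inv b' \<otimes> b' \<in> gen (L - {0})" by simp
    moreover have "b \<otimes> inv b' \<otimes> b' = b"
      using G0.mem_carrier[OF b(1)] G0.mem_carrier[OF b(2)] by (simp add: m_assoc)
    ultimately have "b \<in> gen (L - {0})" by simp
    then have "b \<in> gen K' \<inter> gen (L - {0})" using ab by simp
    also have "\<dots> = gen (K' \<inter> (L - {0}))" using k KL by (intro C0') auto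
    also have "\<dots> \<subseteq> gen (K \<inter> L)" using k KL by (intro mono) auto
    finally have "b \<in> gen (K \<inter> L)" .
    moreover have "gen {..k} \<subseteq> gen (K \<inter> L)" using k l kl KL by (intro mono) auto
    ultimately show "x \<in> gen (K \<inter> L)" using ab by auto
  qed
  have "gen K \<inter> gen L \<subseteq> gen (K \<inter> L)" if KL: "K \<subseteq> {..<n}" "L \<subseteq> {..<n}" for K L
  proof -
    have pos: "M \<subseteq> {1..<n}" if "M \<subseteq> {..<n}" "0 \<notin> M" for M
    proof
      fix x assume "x \<in> M"
      then show "x \<in> {1..<n}" using that by (cases x) auto
    qed
    consider "0 \<notin> K" "0 \<notin> L" | "0 \<in> K" "0 \<notin> L" | "0 \<notin> K" "0 \<in> L" | "0 \<in> K" "0 \<in> L" by blast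
    then show ?thesis
    proof cases
      case 1
      then show ?thesis using C0'[OF pos pos, of K L] KL by simp
    next
      case 2
      then show ?thesis using one_sided[of K L] pos[of L] KL by simp
    next
      case 3
      then show ?thesis using one_sided[of L K] pos[of K] KL by (simp add: Int_commute)
    next
      case 4
      obtain k K' where k: "k < n" "K = {..k} \<union> K'" "K' \<subseteq> {Suc (Suc k)..<n}" using run[of K] 4 KL by blast
      obtain l L' where l: "l < n" "L = {..l} \<union> L'" "L' \<subseteq> {Suc (Suc l)..<n}" using run[of L] 4 KL by blast
      show ?thesis
      proof (cases "k \<le> l")
        case True
        then show ?thesis using two_sided[OF k l] by simp
      next
        case False
        then show ?thesis using two_sided[OF l k] by (simp add: Int_commute)
      qed
    qed
  qed
  moreover have "gen (K \<inter> L) \<subseteq> gen K \<inter> gen L" if "K \<subseteq> {..<n}" "L \<subseteq> {..<n}" for K L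
    using mono[of "K \<inter> L" K] mono[of "K \<inter> L" L] that by simp
  ultimately show ?thesis unfolding string_C_group_def gen_def by blast
qed

end

section \<open>Matrices of reflection words\<close>

text \<open>Column l is the image of b_l. The ring of entries is left open so that one word yields
  both the real matrix and its reduction.\<close>

definition wmat :: "nat \<Rightarrow> (nat \<Rightarrow> nat \<Rightarrow> int) \<Rightarrow> nat list \<Rightarrow> 'a::comm_ring_1 mat" where
  "wmat n A ws = mat n n (\<lambda>(k, l). of_int (act n A ws (unitv l) k))"

lemma wmat_carrier [simp]: "wmat n A ws \<in> carrier_mat n n"
  by (simp add: wmat_def)

lemma wmat_index [simp]: "k < n \<Longrightarrow> l < n \<Longrightarrow> wmat n A ws $$ (k, l) = of_int (act n A ws (unitv l) k)"
  by (simp add: wmat_def)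

lemma wmat_Nil: "wmat n A [] = 1\<^sub>m n"
  by (rule eq_matI) (auto simp: wmat_def unitv_def)

lemma wmat_append: "wmat n A (us @ vs) = wmat n A us * (wmat n A vs :: 'a::comm_ring_1 mat)"
proof (rule eq_matI)
  fix k l
  assume "k < dim_row (wmat n A us * wmat n A vs :: 'a mat)" "l < dim_col (wmat n A us * wmat n A vs :: 'a mat)"
  then have kl: "k < n" "l < n" by (simp_all add: wmat_def)
  have "(wmat n A us * wmat n A vs :: 'a mat) $$ (k, l) =
      (\<Sum>m<n. of_int (act n A us (unitv m) k) * of_int (act n A vs (unitv l) m))"
    using kl by (simp add: wmat_def scalar_prod_def lessThan_atLeast0)
  also have "\<dots> = of_int (act n A us (act n A vs (unitv l)) k)"
    using act_expand[OF kl(1), of A us "act n A vs (unitv l)"] by (simp add: mult.commute)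
  also have "\<dots> = wmat n A (us @ vs) $$ (k, l)"
    using kl by (simp add: act_append)
  finally show "wmat n A (us @ vs) $$ (k, l) = (wmat n A us * wmat n A vs :: 'a mat) $$ (k, l)" ..
qed (simp_all add: wmat_def)

lemma wmat_cong: "act n A us = act n A vs \<Longrightarrow> wmat n A us = wmat n A vs"
  by (simp add: wmat_def)

lemma wmat_real_eqD:
  assumes "wmat n A us = (wmat n A vs :: real mat)" "set us \<subseteq> {..<n}" "set vs \<subseteq> {..<n}"
  shows "act n A us = act n A vs"
proof (rule act_eqI_unitv[OF assms(2,3)])
  fix l k assume "l < n" "k < n"
  then show "act n A us (unitv l) k = act n A vs (unitv l) k"
    using arg_cong[OF assms(1), of "\<lambda>M. M $$ (k, l)"] by simp
qed

lemma of_int_mod_ring_eq_iff: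
  "(of_int x :: 'p::prime_card mod_ring) = of_int y \<longleftrightarrow> int CARD('p) dvd x - y"
  by transfer (rule mod_eq_dvd_iff)

lemma wmat_mod_ring_eq_iff:
  assumes "set us \<subseteq> {..<n}" "set vs \<subseteq> {..<n}"
  shows "wmat n A us = (wmat n A vs :: 'p::prime_card mod_ring mat) \<longleftrightarrow>
    (\<forall>x k. int CARD('p) dvd act n A us x k - act n A vs x k)"
proof
  assume eq: "wmat n A us = (wmat n A vs :: 'p mod_ring mat)"
  have unit: "int CARD('p) dvd act n A us (unitv l) k - act n A vs (unitv l) k" if "l < n" "k < n" for l k
    using arg_cong[OF eq, of "\<lambda>M. M $$ (k, l)"] that by (simp add: of_int_mod_ring_eq_iff)
  show "\<forall>x k. int CARD('p) dvd act n A us x k - act n A vs x k"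
  proof (intro allI)
    fix x k
    show "int CARD('p) dvd act n A us x k - act n A vs x k"
    proof (cases "k < n")
      case True
      have "act n A us x k - act n A vs x k
          = (\<Sum>l<n. x l * (act n A us (unitv l) k - act n A vs (unitv l) k))"
        using act_expand[OF True, of A us x] act_expand[OF True, of A vs x]
        by (simp add: right_diff_distrib sum_subtractf)
      also have "int CARD('p) dvd \<dots>"
        using unit True by (intro dvd_sum dvd_mult) simp
      finally show ?thesis .
    next
      case False
      then have "k \<notin> set us" "k \<notin> set vs" using assms by auto
      then show ?thesis by (simp add: act_outside)
    qed
  qed
next
  assume "\<forall>x k. int CARD('p) dvd act n A us x k - act n A vs x k"
  then show "wmat n A us = (wmat n A vs :: 'p mod_ring mat)"
    by (intro eq_matI) (auto simp: wmat_def of_int_mod_ring_eq_iff)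
qed

lemma group_GL: "group (GL TYPE('a::comm_ring_1) n)"
  unfolding GL_def by (intro monoid.units_group ring.is_monoid ring_mat)

lemma GL_mult [simp]: "x \<otimes>\<^bsub>GL ty n\<^esub> y = x * y"
  by (simp add: GL_def units_of_mult ring_mat_simps)

lemma GL_one [simp]: "\<one>\<^bsub>GL ty n\<^esub> = 1\<^sub>m n"
  by (simp add: GL_def units_of_one ring_mat_simps)

context cartan
begin

lemma wmat_rev: "set ws \<subseteq> {..<n} \<Longrightarrow> wmat n A ws * wmat n A (rev ws) = 1\<^sub>m n"
  unfolding wmat_append[symmetric] wmat_Nil[symmetric, of n A]
  by (intro wmat_cong ext) (simp add: act_append act_rev)

lemma wmat_rev': "set ws \<subseteq> {..<n} \<Longrightarrow> wmat n A (rev ws) * wmat n A ws = 1\<^sub>m n"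
  using wmat_rev[of "rev ws"] by simp

lemma wmat_in_GL: "set ws \<subseteq> {..<n} \<Longrightarrow> wmat n A ws \<in> carrier (GL TYPE('a::comm_ring_1) n)"
  unfolding GL_def units_of_carrier Units_def
  using wmat_rev wmat_rev' by (auto simp: ring_mat_simps intro!: bexI[of _ "wmat n A (rev ws)"])

lemma inv_wmat:
  assumes "set ws \<subseteq> {..<n}"
  shows "inv\<^bsub>GL TYPE('a::comm_ring_1) n\<^esub> (wmat n A ws) = wmat n A (rev ws)"
proof -
  interpret group "GL TYPE('a) n" by (rule group_GL)
  show ?thesis
    using assms by (intro inv_equality) (auto simp: wmat_in_GL wmat_rev')
qed

lemma generate_wmat:
  assumes K: "K \<subseteq> {..<n}"
  shows "generate (GL TYPE('a::comm_ring_1) n) ((\<lambda>i. wmat n A [i]) ` K) = wmat n A ` {ws. set ws \<subseteq> K}"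
proof -
  interpret group "GL TYPE('a) n" by (rule group_GL)
  show ?thesis
  proof (rule generate_words)
    fix i assume "i \<in> K"
    then have i: "set [i] \<subseteq> {..<n}" using K by auto
    then show "wmat n A [i] \<in> carrier (GL TYPE('a) n) \<and>
        wmat n A [i] \<otimes>\<^bsub>GL TYPE('a) n\<^esub> wmat n A [i] = \<one>\<^bsub>GL TYPE('a) n\<^esub>"
      using wmat_rev[OF i] by (simp add: wmat_in_GL)
  next
    fix i ws
    show "wmat n A (i # ws) = wmat n A [i] \<otimes>\<^bsub>GL TYPE('a) n\<^esub> wmat n A ws"
      using wmat_append[of n A "[i]" ws] by simp
  qed (simp add: wmat_Nil)
qed

lemma wmat_commute:
  assumes "i < n" "j < n" "i \<noteq> j" "A i j = 0"
  shows "wmat n A [i] * wmat n A [j] = wmat n A [j] * wmat n A [i]"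
proof -
  have m: "dihedral_order i j = 2" using assms(4) by (simp add: dihedral_order_def)
  have "altw i j 2 = [i, j]" "altw j i 2 = [j, i]" by (simp_all add: numeral_2_eq_2)
  then have "act n A [i, j] = act n A [j, i]"
    using braid[OF assms(1-3)] m by simp
  then show ?thesis
    unfolding wmat_append[symmetric] by (intro wmat_cong) simp
qed

end

section \<open>The Cartan matrix of a crystallographic string group\<close>

text \<open>For indices below n the integrality of the reflection matrices makes the quotient an
  integer, so the floor changes only its type.\<close>

definition cartan_of :: "real mat \<Rightarrow> nat \<Rightarrow> nat \<Rightarrow> int" where
  "cartan_of B i j = \<lfloor>2 * B $$ (i, j) / B $$ (i, i)\<rfloor>"

lemma bform_unit:
  assumes "B \<in> carrier_mat n n" "x \<in> carrier_vec n" "i < n"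
  shows "bform B x (unit_vec n i) = (\<Sum>k<n. x $ k * B $$ (k, i))"
proof -
  have "B *\<^sub>v unit_vec n i = col B i"
    using assms by (intro eq_vecI) auto
  then show ?thesis
    using assms by (simp add: bform_def scalar_prod_def lessThan_atLeast0)
qed

text \<open>The second part ties the prime 3 to the label 6: no other label gives a nonzero product
  of Cartan entries divisible by 3.\<close>

lemma four_cos_squared:
  assumes "m \<in> {2, 3, 4, 6, \<infinity>}"
  shows "4 * (cos_pi_over m)\<^sup>2 \<in> {0, 1, 2, 3, 4}" "4 * (cos_pi_over m)\<^sup>2 = 3 \<Longrightarrow> m = 6"
proof -
  have "4 * (cos_pi_over 2)\<^sup>2 = 0" "4 * (cos_pi_over 3)\<^sup>2 = 1" "4 * (cos_pi_over 4)\<^sup>2 = 2"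
    "4 * (cos_pi_over 6)\<^sup>2 = 3" "4 * (cos_pi_over \<infinity>)\<^sup>2 = 4"
    by (simp_all add: cos_pi_over_def numeral_eq_enat cos_30 cos_45 cos_60 power_divide)
  then show "4 * (cos_pi_over m)\<^sup>2 \<in> {0, 1, 2, 3, 4}" "4 * (cos_pi_over m)\<^sup>2 = 3 \<Longrightarrow> m = 6"
    using assms by (elim insertE emptyE; simp)+
qed

locale crystallographic =
  fixes n :: nat and q :: "nat \<Rightarrow> enat" and B :: "real mat"
  assumes crystallographic: "crystallographic_string n q B"
begin

abbreviation "A \<equiv> cartan_of B"

lemma B_carrier: "B \<in> carrier_mat n n"
  and B_diag: "i < n \<Longrightarrow> B $$ (i, i) > 0"
  and B_off: "i < n \<Longrightarrow> j < n \<Longrightarrow> i \<noteq> j \<Longrightarrow>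
    B $$ (i, j) = - sqrt (B $$ (i, i) * B $$ (j, j)) * cos_pi_over (coxeter_order q i j)"
  and B_int: "i < n \<Longrightarrow> k < n \<Longrightarrow> l < n \<Longrightarrow> refl_mat n B i $$ (k, l) \<in> \<int>"
  using crystallographic unfolding crystallographic_string_def by auto

lemma B_sym: "i < n \<Longrightarrow> j < n \<Longrightarrow> B $$ (i, j) = B $$ (j, i)"
proof -
  assume ij: "i < n" "j < n"
  have "transpose_mat B = B" using crystallographic unfolding crystallographic_string_def by auto
  then have "B $$ (i, j) = transpose_mat B $$ (i, j)" by simp
  then show ?thesis using ij B_carrier by simp
qed

lemma refl_mat_index:
  assumes "i < n" "k < n" "l < n"
  shows "refl_mat n B i $$ (k, l) = (if k = l then 1 else 0) - (if k = i then 2 * B $$ (l, i) / B $$ (i, i) else 0)"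
proof -
  have "bform B (unit_vec n l) (unit_vec n i) = B $$ (l, i)" if "l < n" for l
  proof -
    have "B *\<^sub>v unit_vec n i = col B i"
      using assms B_carrier by (intro eq_vecI) auto
    then show ?thesis using that assms B_carrier by (simp add: bform_def)
  qed
  then show ?thesis
    using assms by (auto simp: refl_mat_def reflection_def)
qed

lemma cartan_of_eq:
  assumes "i < n" "j < n"
  shows "of_int (A i j) = 2 * B $$ (i, j) / B $$ (i, i)"
proof -
  have "refl_mat n B i $$ (i, j) = (if i = j then 1 else 0) - 2 * B $$ (i, j) / B $$ (i, i)"
    using assms by (simp add: refl_mat_index B_sym)
  then have "2 * B $$ (i, j) / B $$ (i, i) = (if i = j then 1 else 0) - refl_mat n B i $$ (i, j)" by simp
  also have "\<dots> \<in> \<int>" using B_int[of i i j] assms by auto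
  finally obtain z where z: "2 * B $$ (i, j) / B $$ (i, i) = of_int z" by (auto elim: Ints_cases)
  then show ?thesis by (simp add: cartan_of_def)
qed

lemma refl_mat_wmat: "i < n \<Longrightarrow> refl_mat n B i = wmat n A [i]"
proof (rule eq_matI)
  fix k l assume i: "i < n" and "k < dim_row (wmat n A [i] :: real mat)" "l < dim_col (wmat n A [i] :: real mat)"
  then have kl: "k < n" "l < n" by (simp_all add: wmat_def)
  then show "refl_mat n B i $$ (k, l) = wmat n A [i] $$ (k, l)"
    using i by (auto simp: refl_mat_index sref_def coroot_unitv cartan_of_eq B_sym) (auto simp: unitv_def)
qed (simp_all add: refl_mat_def wmat_def)

lemma refl_mod_wmat:
  "i < n \<Longrightarrow> refl_mod TYPE('p::prime_card) n B i = wmat n A [i]"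
  unfolding refl_mod_def refl_mat_wmat reduce_mat_def by (rule eq_matI) (auto simp: wmat_def)

lemma coxeter_order_values:
  assumes "i < n" "j < n" "i \<noteq> j"
  shows "coxeter_order q i j \<in> {2, 3, 4, 6, \<infinity>}"
proof -
  have "q k \<in> {2, 3, 4, 6, \<infinity>}" if "1 \<le> k" "k < n" for k
    using crystallographic that unfolding crystallographic_string_def by simp
  then show ?thesis using assms by (simp add: coxeter_order_def)
qed

lemma cartan_of_product:
  assumes "i < n" "j < n" "i \<noteq> j"
  shows "real_of_int (A i j * A j i) = 4 * (cos_pi_over (coxeter_order q i j))\<^sup>2"
proof -
  have "real_of_int (A i j * A j i) = 4 * (B $$ (i, j))\<^sup>2 / (B $$ (i, i) * B $$ (j, j))"
    using assms by (simp add: cartan_of_eq B_sym[of j i] power2_eq_square)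
  also have "(B $$ (i, j))\<^sup>2 = (B $$ (i, i) * B $$ (j, j)) * (cos_pi_over (coxeter_order q i j))\<^sup>2"
    using assms B_diag by (simp add: B_off power_mult_distrib less_imp_le)
  also have "4 * \<dots> / (B $$ (i, i) * B $$ (j, j)) = 4 * (cos_pi_over (coxeter_order q i j))\<^sup>2"
    using B_diag[OF assms(1)] B_diag[OF assms(2)] by simp
  finally show ?thesis .
qed

lemma cartan_of_product_values:
  assumes "i < n" "j < n" "i \<noteq> j"
  shows "A i j * A j i \<in> {0, 1, 2, 3, 4}" "A i j * A j i = 3 \<Longrightarrow> coxeter_order q i j = 6"
proof -
  have "real_of_int (A i j * A j i) \<in> {0, 1, 2, 3, 4}"
    unfolding cartan_of_product[OF assms] by (rule four_cos_squared[OF coxeter_order_values[OF assms]])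
  then show "A i j * A j i \<in> {0, 1, 2, 3, 4}" by (auto simp del: of_int_mult)
  show "coxeter_order q i j = 6" if "A i j * A j i = 3"
    using that cartan_of_product[OF assms] four_cos_squared(2)[OF coxeter_order_values[OF assms]] by simp
qed

sublocale cartan n A
proof
  fix i assume "i < n"
  then show "A i i = 2" using B_diag[of i] by (simp add: cartan_of_def)
next
  fix i j assume ij: "i < n" "j < n" "i \<noteq> j"
  have "cos_pi_over m \<ge> 0" if "m \<in> {2, 3, 4, 6, \<infinity>}" for m
    using that by (auto simp: cos_pi_over_def numeral_eq_enat cos_30 cos_45 cos_60)
  then have "cos_pi_over (coxeter_order q i j) \<ge> 0" using coxeter_order_values[OF ij] by blast
  then have "B $$ (i, j) \<le> 0" using ij B_diag by (simp add: B_off less_imp_le)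
  then have "real_of_int (A i j) \<le> 0"
    using B_diag[of i] ij by (simp add: cartan_of_eq divide_le_0_iff)
  then show "A i j \<le> 0" by simp
next
  fix i j assume ij: "i < n" "j < n" "A i j = 0"
  then have "B $$ (i, j) = 0" using cartan_of_eq[of i j] B_diag[of i] by auto
  then show "A j i = 0" using ij by (simp add: cartan_of_def B_sym)
qed

lemma A_string:
  assumes "i < n" "j < n" "Suc i < j"
  shows "A i j = 0"
  using assms B_off[of i j]
  by (simp add: cartan_of_def coxeter_order_def cos_pi_over_def numeral_eq_enat)

text \<open>A prime dividing the entry divides A i j * A j i, which is 1, 2, 3 or 4. An odd prime
  can only be 3, with label 6, and \<open>generic\<close> excludes this.\<close>

lemma generic_not_dvd:
  assumes p: "prime p" "odd p" "generic p n q" and ij: "i < n" "j < n" "j = Suc i \<or> i = Suc j" and "A i j \<noteq> 0"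
  shows "\<not> int p dvd A i j"
proof
  assume "int p dvd A i j"
  then have dvd: "int p dvd A i j * A j i" by simp
  have ne: "A i j * A j i \<noteq> 0" using assms zero_sym[of j i] by auto
  have neq: "i \<noteq> j" using ij by auto
  have vals: "A i j * A j i \<in> {1, 2, 3, 4}" using cartan_of_product_values(1)[OF ij(1,2) neq] ne by auto
  have "int p \<le> A i j * A j i" using dvd vals by (intro zdvd_imp_le) auto
  then have "p \<le> 4" using vals by auto
  moreover have "p \<noteq> 2" "p \<noteq> 4" "p \<ge> 2" using p prime_ge_2_nat by auto
  ultimately have p3: "p = 3" by linarith
  then have "A i j * A j i = 3" using dvd vals by auto
  then have "coxeter_order q i j = 6" using cartan_of_product_values(2)[OF ij(1,2) neq] by blast
  then show False using p(3) p3 ij unfolding generic_def coxeter_order_def by (auto split: if_splits)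
qed

end

section \<open>Euclidean type\<close>

lemma vec_span_finite:
  assumes "finite S" "S \<subseteq> carrier_vec n"
  shows "x \<in> vec_span n S \<longleftrightarrow> x \<in> carrier_vec n \<and> (\<exists>a. \<forall>k<n. x $ k = (\<Sum>v\<in>S. a v * v $ k))"
proof -
  interpret vec_space "TYPE(real)" n .
  have span_eq: "span S = {lincomb a S |a. True}"
    using finite_span[OF assms(1)] assms(2) by simp
  have carrier: "lincomb a S \<in> carrier_vec n" for a
    using assms(2) by (rule lincomb_closed)
  show ?thesis
  proof
    assume "x \<in> span S"
    then obtain a where "x = lincomb a S" unfolding span_eq by blast
    then show "x \<in> carrier_vec n \<and> (\<exists>a. \<forall>k<n. x $ k = (\<Sum>v\<in>S. a v * v $ k))"
      using carrier lincomb_index[OF _ assms(2)] by auto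
  next
    assume "x \<in> carrier_vec n \<and> (\<exists>a. \<forall>k<n. x $ k = (\<Sum>v\<in>S. a v * v $ k))"
    then obtain a where x: "x \<in> carrier_vec n" "\<And>k. k < n \<Longrightarrow> x $ k = (\<Sum>v\<in>S. a v * v $ k)" by blast
    have "x = lincomb a S"
    proof (rule eq_vecI)
      fix k assume "k < dim_vec (lincomb a S)"
      then have "k < n" using carrier[of a] by simp
      then show "x $ k = lincomb a S $ k" using x(2) lincomb_index[OF _ assms(2)] by simp
    qed (use x(1) carrier[of a] in simp)
    then show "x \<in> span S" unfolding span_eq by blast
  qed
qed

lemma root_span_eq:
  assumes "n \<ge> 1"
  shows "root_span n = {x \<in> carrier_vec n. x $ (n - 1) = 0}"
proof -
  note One_nat_def [simp del]
  let ?S = "unit_vec n ` {..<n - 1} :: real vec set"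
  have inj: "inj_on (unit_vec n) {..<n - 1}"
    by (rule inj_onI) simp
  have sum_eq: "(\<Sum>v\<in>?S. a v * v $ k) = (if k < n - 1 then a (unit_vec n k) else 0)" if "k < n" for a k
  proof -
    have "(\<Sum>v\<in>?S. a v * v $ k) = (\<Sum>i<n - 1. a (unit_vec n i) * unit_vec n i $ k)"
      by (subst sum.reindex[OF inj]) simp
    also have "\<dots> = (\<Sum>i<n - 1. if i = k then a (unit_vec n k) else 0)"
      using that by (intro sum.cong) auto
    finally show ?thesis by simp
  qed
  have span: "x \<in> root_span n \<longleftrightarrow> x \<in> carrier_vec n \<and> (\<exists>a. \<forall>k<n. x $ k = (if k < n - 1 then a (unit_vec n k :: real vec) else 0))" for x
    unfolding root_span_def by (subst vec_span_finite) (simp_all add: sum_eq image_subset_iff)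
  show ?thesis
  proof (intro subset_antisym subsetI)
    fix x :: "real vec" assume "x \<in> root_span n"
    then show "x \<in> {x \<in> carrier_vec n. x $ (n - 1) = 0}"
      using assms by (auto simp: span)
  next
    fix x :: "real vec" assume x: "x \<in> {x \<in> carrier_vec n. x $ (n - 1) = 0}"
    have "x $ k = (if k < n - 1 then x \<bullet> unit_vec n k else 0)" if "k < n" for k
    proof (cases "k < n - 1")
      case True
      then show ?thesis using x that by simp
    next
      case False
      then have "k = n - 1" using that by simp
      then show ?thesis using x by simp
    qed
    then show "x \<in> root_span n"
      \<comment> \<open>The coefficient at a unit vector v is recovered as its scalar product with
        x.\<close>
      using x unfolding span by (intro conjI exI[of _ "\<lambda>v. x \<bullet> v"]) auto
  qed
qed

text \<open>Two points of the affine hyperplane that differ by the form x \<mapsto> c_a x_b - c_b x_a, which vanishes at c,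
  are moved by the same amount.\<close>

lemma acts_as_translation_parallel:
  fixes c :: "real vec"
  assumes tr: "acts_as_translation n c g" and n: "n \<ge> 1" and c: "c \<in> root_span n" "c \<noteq> 0\<^sub>v n"
    and x: "x \<in> root_span n" and y: "inv\<^bsub>GL TYPE(real) n\<^esub> g *\<^sub>v x = y"
    and ab: "a < n" "b < n"
  shows "c $ a * (y $ b - x $ b) = c $ b * (y $ a - x $ a)"
proof -
  have carr: "root_span n \<subseteq> carrier_vec n" using root_span_eq[OF n] by auto
  obtain i where i: "i < n" "c $ i \<noteq> 0"
  proof (rule ccontr)
    assume *: "\<not> thesis"
    have "c = 0\<^sub>v n"
      using c(1) carr * that by (intro eq_vecI) auto
    then show False using c(2) by simp
  qed
  define \<phi> where "\<phi> z = z $ i / c $ i" for z :: "real vec"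
  define \<psi> where "\<psi> z = z $ i / c $ i + (c $ a * z $ b - c $ b * z $ a)" for z :: "real vec"
  obtain t where t: "\<And>\<phi>. linear_form_on (root_span n) \<phi> \<Longrightarrow> \<phi> c = 1 \<Longrightarrow> \<phi> y = \<phi> x + t x"
    using tr x y unfolding acts_as_translation_def by blast
  have "linear_form_on (root_span n) \<phi>" "linear_form_on (root_span n) \<psi>"
    unfolding linear_form_on_def \<phi>_def \<psi>_def using carr i ab
    by (auto simp: add_divide_distrib algebra_simps subset_iff)
  moreover have "\<phi> c = 1" "\<psi> c = 1" using i by (simp_all add: \<phi>_def \<psi>_def)
  ultimately have "\<phi> y = \<phi> x + t x" "\<psi> y = \<psi> x + t x" using t by blast+
  then show ?thesis by (simp add: \<phi>_def \<psi>_def algebra_simps)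
qed

definition int_vec :: "nat \<Rightarrow> (nat \<Rightarrow> int) \<Rightarrow> real vec" where
  "int_vec n x = vec n (\<lambda>k. of_int (x k))"

lemma int_vec_index [simp]: "k < n \<Longrightarrow> int_vec n x $ k = of_int (x k)"
  by (simp add: int_vec_def)

lemma int_vec_carrier [simp]: "int_vec n x \<in> carrier_vec n"
  by (simp add: int_vec_def)

lemma int_vec_root_span: "n \<ge> 1 \<Longrightarrow> x (n - 1) = 0 \<Longrightarrow> int_vec n x \<in> root_span n"
  by (simp add: root_span_eq)

lemma wmat_int_vec: "wmat n A ws *\<^sub>v int_vec n x = int_vec n (act n A ws x)"
proof (rule eq_vecI)
  fix k assume "k < dim_vec (int_vec n (act n A ws x))"
  then have k: "k < n" by (simp add: int_vec_def)
  have "(wmat n A ws *\<^sub>v int_vec n x) $ k = (\<Sum>l<n. of_int (act n A ws (unitv l) k) * of_int (x l))"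
    using k by (simp add: wmat_def scalar_prod_def lessThan_atLeast0 int_vec_def)
  also have "\<dots> = of_int (act n A ws x k)"
    using act_expand[OF k, of A ws x] by (simp add: mult.commute)
  finally show "(wmat n A ws *\<^sub>v int_vec n x) $ k = int_vec n (act n A ws x) $ k"
    using k by simp
qed (simp add: wmat_def int_vec_def)

context crystallographic
begin

lemma G_par_wmat:
  "G_par n B J = wmat n A ` {ws. set ws \<subseteq> {..<n} - J}"
proof -
  have "refl_mat n B ` ({..<n} - J) = (\<lambda>i. wmat n A [i]) ` ({..<n} - J)"
    by (intro image_cong) (auto simp: refl_mat_wmat)
  then show ?thesis unfolding G_par_def by (simp add: generate_wmat)
qed

lemma coroot_real:
  assumes "j < n"
  shows "B $$ (j, j) * of_int (coroot n A j x) = 2 * (\<Sum>k<n. of_int (x k) * B $$ (k, j))"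
proof -
  have "B $$ (j, j) * of_int (coroot n A j x) = (\<Sum>k<n. B $$ (j, j) * of_int (A j k) * of_int (x k))"
    by (simp add: coroot_def sum_distrib_left mult.assoc)
  also have "\<dots> = (\<Sum>k<n. 2 * (of_int (x k) * B $$ (k, j)))"
  proof (intro sum.cong refl)
    fix k assume "k \<in> {..<n}"
    then have "B $$ (j, j) * of_int (A j k) = 2 * B $$ (k, j)"
      using assms B_diag[OF assms] B_sym[of j k] by (simp add: cartan_of_eq)
    then show "B $$ (j, j) * of_int (A j k) * of_int (x k) = 2 * (of_int (x k) * B $$ (k, j))" by simp
  qed
  finally show ?thesis by (simp add: sum_distrib_left)
qed

lemma radical_iff:
  assumes n: "n \<ge> 1" and x: "x (n - 1) = 0"
  shows "int_vec n x \<in> radical n B \<longleftrightarrow> (\<forall>j<n - 1. coroot n A j x = 0)"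
proof
  assume rad: "int_vec n x \<in> radical n B"
  show "\<forall>j<n - 1. coroot n A j x = 0"
  proof (intro allI impI)
    fix j assume j: "j < n - 1"
    have "unit_vec n j \<in> root_span n" using j by (simp add: root_span_eq[OF n])
    then have "bform B (int_vec n x) (unit_vec n j) = 0" using rad by (simp add: radical_def)
    then have "B $$ (j, j) * of_int (coroot n A j x) = 0"
      using j by (simp add: coroot_real bform_unit[OF B_carrier])
    moreover have "B $$ (j, j) > 0" using j by (intro B_diag) simp
    ultimately show "coroot n A j x = 0" by simp
  qed
next
  assume zero: "\<forall>j<n - 1. coroot n A j x = 0"
  have "bform B (int_vec n x) z = 0" if z: "z \<in> root_span n" for z
  proof -
    have zc: "z \<in> carrier_vec n" "z $ (n - 1) = 0" using z root_span_eq[OF n] by auto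
    have "bform B (int_vec n x) z = (\<Sum>k<n. of_int (x k) * (\<Sum>j<n. B $$ (k, j) * z $ j))"
      using B_carrier zc by (simp add: bform_def scalar_prod_def lessThan_atLeast0)
    also have "\<dots> = (\<Sum>j<n. z $ j * (\<Sum>k<n. of_int (x k) * B $$ (k, j)))"
      by (simp add: sum_distrib_left) (subst sum.swap, simp add: mult_ac)
    also have "\<dots> = 0"
    proof (intro sum.neutral ballI)
      fix j assume "j \<in> {..<n}"
      then show "z $ j * (\<Sum>k<n. of_int (x k) * B $$ (k, j)) = 0"
        using zero coroot_real[of j x] zc(2) by (cases "j = n - 1") auto
    qed
    finally show ?thesis .
  qed
  then show "int_vec n x \<in> radical n B"
    using int_vec_root_span[of n x] n x by (simp add: radical_def)
qed

text \<open>The hypotheses give only a real radical vector \<open>c0\<close>. An integral one is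
  found by splitting r_0 itself as t0 w0: the translation t0 sends w0 b_0 to r_0 b_0 = -b_0, a
  displacement by -(b_0 + w0 b_0), and translations displace along \<open>c0\<close>.\<close>

theorem euclidean_cartan_exists:
  assumes eucl: "euclidean_type n B"
    and semi: "internal_semidirect (GL TYPE(real) n\<lparr>carrier := G_par n B {n - 1}\<rparr>)
      (translation_subgroup n B) (G_par n B {0, n - 1})"
    and p: "prime p" "odd p" "generic p n q"
  shows "\<exists>c w0. euclidean_cartan n A (\<lambda>i. B $$ (i, i)) c w0 (int p)"
proof -
  obtain c0 where c0: "c0 \<in> carrier_vec n" "c0 \<noteq> 0\<^sub>v n" "radical n B = vec_span n {c0}"
    using eucl unfolding euclidean_type_def by blast
  have c0_rad: "c0 \<in> radical n B"
    unfolding c0(3) using c0(1) by (subst vec_span_finite) (auto intro!: exI[of _ "\<lambda>_. 1"])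
  then have c0_span: "c0 \<in> root_span n" by (simp add: radical_def)
  have n1: "n \<ge> 1"
  proof (rule ccontr)
    assume "\<not> n \<ge> 1"
    then have "c0 = 0\<^sub>v n" using c0(1) by (intro eq_vecI) auto
    then show False using c0(2) by simp
  qed
  have c0_last: "c0 $ (n - 1) = 0" using c0_span root_span_eq[OF n1] by simp
  have n2: "n \<ge> 2"
  proof (rule ccontr)
    assume "\<not> n \<ge> 2"
    then have "n = 1" using n1 by simp
    then have "c0 = 0\<^sub>v n" using c0(1) c0_last by (intro eq_vecI) auto
    then show False using c0(2) by simp
  qed
  have sets: "{..<n} - {n - 1} = {..<n - 1}" "{..<n} - {0, n - 1} = {1..<n - 1}" by auto
  have split: "\<exists>t h. set t \<subseteq> {..<n - 1} \<and> set h \<subseteq> {1..<n - 1} \<and> act n A g = act n A (t @ h) \<and>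
      acts_as_translation n c0 (wmat n A t)" if g: "set g \<subseteq> {..<n - 1}" for g
  proof -
    have gn: "set g \<subseteq> {..<n}" by (rule subset_trans[OF g]) auto
    have "wmat n A g \<in> G_par n B {n - 1}" using g unfolding G_par_wmat sets by blast
    then have "wmat n A g \<in> translation_subgroup n B <#>\<^bsub>GL TYPE(real) n\<^esub> G_par n B {0, n - 1}"
      using semi unfolding internal_semidirect_def by (simp add: set_mult_def)
    then obtain T H where T: "T \<in> translation_subgroup n B" and H: "H \<in> G_par n B {0, n - 1}"
      and TH: "wmat n A g = T * H" by (auto simp: set_mult_def)
    obtain t where t: "T = wmat n A t" "set t \<subseteq> {..<n - 1}"
      using T unfolding translation_subgroup_def G_par_wmat sets by blast
    obtain h where h: "H = wmat n A h" "set h \<subseteq> {1..<n - 1}"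
      using H unfolding G_par_wmat sets by blast
    have tn: "set (t @ h) \<subseteq> {..<n}" using t(2) h(2) by fastforce
    have "wmat n A g = (wmat n A (t @ h) :: real mat)"
      using TH t h by (simp add: wmat_append)
    then have "act n A g = act n A (t @ h)" using gn tn by (rule wmat_real_eqD)
    moreover have "acts_as_translation n c0 (wmat n A t)"
      using T c0_rad c0(2) unfolding translation_subgroup_def t(1) by blast
    ultimately show ?thesis using t h by blast
  qed
  have parallel: "c0 $ a * of_int (act n A t z b - z b) = c0 $ b * of_int (act n A t z a - z a)"
    if t: "set t \<subseteq> {..<n - 1}" and tr: "acts_as_translation n c0 (wmat n A t)"
      and z: "z (n - 1) = 0" and ab: "a < n" "b < n" for t z a b
  proof -
    have tn: "set t \<subseteq> {..<n}" by (rule subset_trans[OF t]) auto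
    have "act n A t z (n - 1) = 0" using t z by (subst act_outside) auto
    then have span: "int_vec n (act n A t z) \<in> root_span n" by (rule int_vec_root_span[OF n1])
    \<comment> \<open>Translations are defined through the inverse matrix, so the criterion is
      applied to t z, whose image is z.\<close>
    have inv: "inv\<^bsub>GL TYPE(real) n\<^esub> (wmat n A t) *\<^sub>v int_vec n (act n A t z) = int_vec n z"
      by (simp add: inv_wmat[OF tn] wmat_int_vec act_rev'[OF tn])
    show ?thesis
      using acts_as_translation_parallel[OF tr n1 c0_span c0(2) span inv ab] ab
      by (simp add: algebra_simps)
  qed
  obtain t0 w0 where t0: "set t0 \<subseteq> {..<n - 1}" "acts_as_translation n c0 (wmat n A t0)"
    and w0: "set w0 \<subseteq> {1..<n - 1}" and tw: "act n A [0] = act n A (t0 @ w0)"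
    using split[of "[0]"] n2 by auto
  define c where "c k = unitv 0 k + act n A w0 (unitv 0) k" for k
  have c_out: "c k = 0" if "k \<ge> n - 1" for k
  proof -
    have "k \<notin> set w0" using w0 that by auto
    then show ?thesis using that n2 by (simp add: c_def act_outside unitv_def)
  qed
  have "0 \<notin> set w0" using w0 by auto
  then have c_0: "c 0 = 2" by (simp add: c_def act_outside)
  have proportional: "c0 $ a * of_int (c b) = c0 $ b * of_int (c a)" if ab: "a < n" "b < n" for a b
  proof -
    define z where "z = act n A w0 (unitv 0)"
    have "n - 1 \<notin> set w0" using w0 by auto
    then have z: "z (n - 1) = 0" using n2 by (simp add: z_def act_outside unitv_def)
    have "act n A t0 z = act n A [0] (unitv 0)" by (simp add: tw act_append z_def)
    also have "\<dots> = (\<lambda>k. - unitv 0 k)" using n2 by (simp add: s_unitv_self)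
    finally have "act n A t0 z k - z k = - c k" for k by (simp add: c_def z_def)
    then show ?thesis using parallel[OF t0, of z a b] z ab by simp
  qed
  \<comment> \<open>Since c 0 = 2 is nonzero, \<open>proportional\<close> ties every coefficient of
    c0 to the one at b_0.\<close>
  have c0_0: "c0 $ 0 \<noteq> 0"
  proof
    assume "c0 $ 0 = 0"
    then have "c0 $ a = 0" if "a < n" for a using proportional[of a 0] that n2 c_0 by simp
    then have "c0 = 0\<^sub>v n" using c0(1) by (intro eq_vecI) auto
    then show False using c0(2) by simp
  qed
  have c_scale: "of_int (c a) = 2 / c0 $ 0 * c0 $ a" if "a < n" for a
    using proportional[of a 0] that n2 c_0 c0_0 by (simp add: field_simps)
  have span_iff: "x \<in> radical n B \<longleftrightarrow> x \<in> carrier_vec n \<and> (\<exists>r. \<forall>k<n. x $ k = r * c0 $ k)" for x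
  proof -
    have "x \<in> radical n B \<longleftrightarrow> x \<in> carrier_vec n \<and> (\<exists>a. \<forall>k<n. x $ k = a c0 * c0 $ k)"
      unfolding c0(3) using c0(1) by (subst vec_span_finite) auto
    also have "(\<exists>a. \<forall>k<n. x $ k = a c0 * c0 $ k) \<longleftrightarrow> (\<exists>r. \<forall>k<n. x $ k = r * c0 $ k)"
    proof
      assume "\<exists>r. \<forall>k<n. x $ k = r * c0 $ k"
      then obtain r where "\<forall>k<n. x $ k = r * c0 $ k" by blast
      then show "\<exists>a. \<forall>k<n. x $ k = a c0 * c0 $ k" by (intro exI[of _ "\<lambda>_. r"]) simp
    qed blast
    finally show ?thesis .
  qed
  have "int_vec n c \<in> radical n B"
    unfolding span_iff using c_scale by (intro conjI exI[of _ "2 / c0 $ 0"]) auto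
  then have c_rad: "\<And>j. j < n - 1 \<Longrightarrow> coroot n A j c = 0"
    using radical_iff[OF n1, of c] c_out[of "n - 1"] by simp
  have p': "prime (int p)" "odd (int p)" using p by simp_all
  have "euclidean_cartan n A (\<lambda>i. B $$ (i, i)) c w0 (int p)"
  proof
    fix y :: "nat \<Rightarrow> int" and i
    assume y_out: "\<And>k. n - 1 \<le> k \<Longrightarrow> y k = 0" and y: "\<And>j. j < n - 1 \<Longrightarrow> coroot n A j y = 0"
    show "2 * y i = y 0 * c i"
    proof (cases "i < n")
      case True
      have "int_vec n y \<in> radical n B" using radical_iff[OF n1, of y] y_out[of "n - 1"] y by simp
      then obtain r where r: "\<And>k. k < n \<Longrightarrow> int_vec n y $ k = r * c0 $ k" unfolding span_iff by blast
      have "2 * real_of_int (y i) = 2 * (r * c0 $ i)" using r[OF True] True by simp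
      also have "\<dots> = (r * c0 $ 0) * of_int (c i)" using c_scale[OF True] c0_0 by simp
      also have "r * c0 $ 0 = of_int (y 0)" using r[of 0] n2 by simp
      finally have "real_of_int (2 * y i) = of_int (y 0 * c i)" by simp
      then show ?thesis by (simp only: of_int_eq_iff)
    next
      case False
      then show ?thesis using y_out[of i] c_out[of i] by simp
    qed
  next
    fix g assume "set g \<subseteq> {..<n - 1}"
    from split[OF this] obtain t h where t: "set t \<subseteq> {..<n - 1}" "acts_as_translation n c0 (wmat n A t)"
      and h: "set h \<subseteq> {1..<n - 1}" "act n A g = act n A (t @ h)" by blast
    have "2 * (act n A t x i - x i) = (act n A t x 0 - x 0) * c i" if x: "\<forall>k\<ge>n - 1. x k = 0" for x i
    proof (cases "i < n")
      case True
      have "c0 $ 0 * of_int (act n A t x i - x i) = c0 $ i * of_int (act n A t x 0 - x 0)"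
        using parallel[OF t, of x 0 i] x True n2 by simp
      also have "c0 $ i = c0 $ 0 / 2 * of_int (c i)" using c_scale[OF True] c0_0 by simp
      finally have "c0 $ 0 * (2 * real_of_int (act n A t x i - x i))
          = c0 $ 0 * (of_int (act n A t x 0 - x 0) * of_int (c i))"
        by (simp add: mult.commute del: of_int_diff)
      then have "2 * real_of_int (act n A t x i - x i) = of_int (act n A t x 0 - x 0) * of_int (c i)"
        using c0_0 by (simp only: mult_cancel_left simp_thms)
      then have "real_of_int (2 * (act n A t x i - x i)) = of_int ((act n A t x 0 - x 0) * c i)"
        by (simp only: of_int_mult of_int_numeral)
      then show ?thesis by (simp only: of_int_eq_iff)
    next
      case False
      then have "i \<notin> set t" using t(1) by auto
      then show ?thesis using c_out[of i] False by (simp add: act_outside)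
    qed
    then show "\<exists>t h. set t \<subseteq> {..<n - 1} \<and> set h \<subseteq> {1..<n - 1} \<and> act n A g = act n A (t @ h) \<and>
      (\<forall>x. (\<forall>k\<ge>n - 1. x k = 0) \<longrightarrow> (\<forall>i. 2 * (act n A t x i - x i) = (act n A t x 0 - x 0) * c i))"
      using t(1) h by blast
  next
    fix i j assume ij: "i < n" "j < n"
    show "B $$ (i, i) * real_of_int (A i j) = B $$ (j, j) * real_of_int (A j i)"
      using ij B_diag[of i] B_diag[of j] B_sym[of i j] by (simp add: cartan_of_eq)
  qed (use n2 w0 c_def c_rad p' p A_string B_diag generic_not_dvd in auto)
  then show ?thesis by blast
qed

theorem reduced_string_C_if_facet:
  assumes "euclidean_type n B"
    and "internal_semidirect (GL TYPE(real) n\<lparr>carrier := G_par n B {n - 1}\<rparr>)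
      (translation_subgroup n B) (G_par n B {0, n - 1})"
    and "odd CARD('p::prime_card)" "generic CARD('p) n q"
    and facet: "reduced_string_C TYPE('p) n B {0}"
  shows "reduced_string_C TYPE('p) n B {}"
proof -
  obtain c w0 where "euclidean_cartan n A (\<lambda>i. B $$ (i, i)) c w0 (int CARD('p))"
    using euclidean_cartan_exists assms prime_card[where 'a = 'p] by blast
  then interpret E: euclidean_cartan n A "\<lambda>i. B $$ (i, i)" c w0 "int CARD('p)" .
  interpret H: group "GL TYPE('p mod_ring) n" by (rule group_GL)
  let ?r = "refl_mod TYPE('p) n B"
  have gen: "generate (GL TYPE('p mod_ring) n) (?r ` K) = wmat n A ` {ws. set ws \<subseteq> K}"
    if "K \<subseteq> {..<n}" for K
  proof -
    have "?r ` K = (\<lambda>i. wmat n A [i]) ` K"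
      using that by (intro image_cong) (auto simp: refl_mod_wmat)
    then show ?thesis using generate_wmat[OF that] by simp
  qed
  have zero: "{..<n} - {0} = {1..<n}" by auto
  have "string_C_group (GL TYPE('p mod_ring) n) ?r {..<n}"
  proof (rule H.string_C_groupI)
    show "?r i \<in> carrier (GL TYPE('p mod_ring) n)" if "i < n" for i
      using that by (simp add: refl_mod_wmat wmat_in_GL)
    show "?r i \<otimes>\<^bsub>GL TYPE('p mod_ring) n\<^esub> ?r j = ?r j \<otimes>\<^bsub>GL TYPE('p mod_ring) n\<^esub> ?r i"
      if "i < n" "j < n" "Suc i < j" for i j
      using that wmat_commute[of i j] A_string by (simp add: refl_mod_wmat)
    show "string_C_group (GL TYPE('p mod_ring) n) ?r {1..<n}"
      using facet unfolding reduced_string_C_def zero .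
    fix k assume k: "k < n"
    show "generate (GL TYPE('p mod_ring) n) (?r ` {..k}) \<inter> generate (GL TYPE('p mod_ring) n) (?r ` {1..<n})
        \<subseteq> generate (GL TYPE('p mod_ring) n) (?r ` {1..k})"
    proof
      fix x
      assume x: "x \<in> generate (GL TYPE('p mod_ring) n) (?r ` {..k}) \<inter> generate (GL TYPE('p mod_ring) n) (?r ` {1..<n})"
      have sets: "{..k} \<subseteq> {..<n}" "{1..<n} \<subseteq> {..<n}" "{1..k} \<subseteq> {..<n}" using k by auto
      obtain g v where g: "x = wmat n A g" "set g \<subseteq> {..k}" and v: "x = wmat n A v" "set v \<subseteq> {1..<n}"
        using x unfolding gen[OF sets(1)] gen[OF sets(2)] by blast
      show "x \<in> generate (GL TYPE('p mod_ring) n) (?r ` {1..k})"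
      proof (cases "k < n - 1")
        case False
        \<comment> \<open>For k = n - 1 the group G_0^p is itself <r_1, ..., r_k>.\<close>
        then have "{1..<n} = {1..k}" using k by auto
        then show ?thesis using x by simp
      next
        case True
        have gn: "set g \<subseteq> {..<n}" "set v \<subseteq> {..<n}" using g v sets by blast+
        have "wmat n A g = (wmat n A v :: 'p mod_ring mat)" using g v by simp
        then have "E.congruent g v"
          unfolding E.congruent_def using wmat_mod_ring_eq_iff[OF gn] by blast
        then obtain us where us: "set us \<subseteq> {1..k}" "E.congruent us g"
          using E.parabolic_congruent[OF True g(2) v(2)] by blast
        have usn: "set us \<subseteq> {..<n}" using us(1) sets by blast
        have "wmat n A us = (wmat n A g :: 'p mod_ring mat)"
          using us(2) wmat_mod_ring_eq_iff[OF usn gn(1)] unfolding E.congruent_def by blast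
        then show ?thesis unfolding gen[OF sets(3)] using g(1) us(1) by (intro image_eqI[of _ _ us]) auto
      qed
    qed
  qed
  then show ?thesis by (simp add: reduced_string_C_def)
qed

end

theorem theorem2p4:
  fixes n p :: nat and q :: "nat \<Rightarrow> enat" and B :: "real mat"
  assumes "crystallographic_string n q B"
    and "euclidean_type n B"
    and "internal_semidirect (GL TYPE(real) n\<lparr>carrier := G_par n B {n - 1}\<rparr>)
           (translation_subgroup n B) (G_par n B {0, n - 1})"
    and "p = CARD('p::prime_card)" and "odd p" and "generic p n q"
    and "reduced_string_C TYPE('p) n B {0}"
  shows "reduced_string_C TYPE('p) n B {}"
proof -
  interpret crystallographic n q B by unfold_locales (rule assms(1))
  show ?thesis
    using assms(2-7) by (intro reduced_string_C_if_facet) simp_all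
qed

end
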